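(* Consider the location model $X_t=\mu_t+e_t$, $1\le t\le T$, with $Ee_t=0$, and suppose the null hypothesis $H_0:\ \mu_1=\mu_2=\cdots=\mu_T$ holds. Let $t_T$ be a trimming sequence of integers with $t_T\to\infty$ and $t_T/T\to 0$ as $T\to\infty$. Suppose Assumption (A) below holds with constants $\sigma>0$, $0<\kappa<1/2$. Define $$D_T=\max_{t_T\le t\le T-t_T}\left|\frac1t\sum_{s=1}^tX_s-\frac1{T-t}\sum_{s=t+1}^TX_s\right|.$$ Then, as $T\to\infty$, $$t_T^{1/2}\frac{D_T}{\sigma}\xrightarrow{\mathcal D}\max(\xi_1,\xi_2),$$ where $\xi_1,\xi_2$ are independent, each distributed as $\xi=\sup_{0\le u\le1}|W(u)|$ with $W$ a standard Wiener process.
   Context: Assumption (A) (strong approximation): for each $T$ there are independent standard Wiener processes $\{W_{T,1}(x),0\le x\le T/2\}$ and $\{W_{T,2}(x),0\le x\le T/2\}$ such that $$\max_{1\le x\le T/2}x^{-\kappa}\Big|\sum_{s=1}^{\lfloor x\rfloor}e_s-\sigma W_{T,1}(x)\Big|=O_P(1)$$ and $$\max_{T/2\le x\le T-1}(T-x)^{-\kappa}\Big|\sum_{s=\lfloor x\rfloor+1}^{T}e_s-\sigma W_{T,2}(T-x)\Big|=O_P(1),$$ for some $\sigma>0$ and $0<\kappa<1/2$. *)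

theory Defs
  imports "HOL-Probability.Probability"
begin

definition wiener_on :: "'a measure \<Rightarrow> real \<Rightarrow> (real \<Rightarrow> 'a \<Rightarrow> real) \<Rightarrow> bool" where
  "wiener_on M L W \<longleftrightarrow>
     (\<forall>t\<in>{0..L}. W t \<in> borel_measurable M) \<and>
     (\<forall>\<omega>\<in>space M. W 0 \<omega> = 0) \<and>
     (\<forall>\<omega>\<in>space M. continuous_on {0..L} (\<lambda>t. W t \<omega>)) \<and>
     (\<forall>s t. 0 \<le> s \<longrightarrow> s < t \<longrightarrow> t \<le> L \<longrightarrow>
        distributed M lborel (\<lambda>\<omega>. W t \<omega> - W s \<omega>)
          (\<lambda>x. ennreal (normal_density 0 (sqrt (t - s)) x))) \<and>
     (\<forall>(n::nat) (ts::nat \<Rightarrow> real). (\<forall>i\<le>n. 0 \<le> ts i \<and> ts i \<le> L) \<longrightarrow>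
        (\<forall>i<n. ts i < ts (Suc i)) \<longrightarrow>
        prob_space.indep_vars M (\<lambda>_. borel) (\<lambda>i \<omega>. W (ts (Suc i)) \<omega> - W (ts i) \<omega>) {..<n})"

definition indep_processes :: "'a measure \<Rightarrow> real \<Rightarrow> (real \<Rightarrow> 'a \<Rightarrow> real) \<Rightarrow> (real \<Rightarrow> 'a \<Rightarrow> real) \<Rightarrow> bool" where
  "indep_processes M L W1 W2 \<longleftrightarrow>
     prob_space.indep_var M
       (Pi\<^sub>M {0..L} (\<lambda>_. borel)) (\<lambda>\<omega>. \<lambda>t\<in>{0..L}. W1 t \<omega>)
       (Pi\<^sub>M {0..L} (\<lambda>_. borel)) (\<lambda>\<omega>. \<lambda>t\<in>{0..L}. W2 t \<omega>)"

text \<open>A sequence of real random variables Z T is O_P(1) (bounded in probability),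
  phrased through measurable events so that it also makes sense for possibly
  non-measurable Z T.\<close>
definition bounded_in_prob :: "'a measure \<Rightarrow> (nat \<Rightarrow> 'a \<Rightarrow> real) \<Rightarrow> bool" where
  "bounded_in_prob M Z \<longleftrightarrow>
     (\<forall>\<epsilon>>0. \<exists>C. \<exists>T0. \<forall>T\<ge>T0. \<exists>A\<in>sets M. measure M A \<ge> 1 - \<epsilon> \<and> (\<forall>\<omega>\<in>A. \<bar>Z T \<omega>\<bar> \<le> C))"

definition D_stat :: "(nat \<Rightarrow> 'a \<Rightarrow> real) \<Rightarrow> nat \<Rightarrow> nat \<Rightarrow> 'a \<Rightarrow> real" where
  "D_stat X tT T \<omega> =
     Max ((\<lambda>t. \<bar>(1 / real t) * (\<Sum>s=1..t. X s \<omega>)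
               - (1 / (real T - real t)) * (\<Sum>s=t+1..T. X s \<omega>)\<bar>) ` {tT..T - tT})"

end

theory Submission
  imports Defs
begin

text \<open>Under the null hypothesis the mean cancels and only partial sums of the errors remain. For
  \<open>t \<le> T/2\<close> the second average has order \<open>T\<^sup>-\<^sup>1\<^sup>/\<^sup>2\<close>, which vanishes after multiplication by the square root
  of the trimming point \<open>n\<close>, and the first one is \<open>\<sigma> W\<^sub>1(t) / t\<close> up to \<open>C t\<^sup>\<kappa>\<^sup>-\<^sup>1\<close>; symmetrically
  for \<open>t \<ge> T/2\<close>. So the statistic is the maximum over \<open>i\<close> of the suprema of \<open>\<surd>n |W\<^sub>i(x)| / x\<close> over
  \<open>[n, T/2]\<close>, up to a term tending to 0 in probability. By time inversion
  the process \<open>u \<mapsto> u W(n/u) / \<surd>n\<close> has the law of a Wiener process, so these suprema have exactly the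
  law of the suprema of two independent Wiener processes over \<open>[2n/T, 1]\<close>, and \<open>n/T \<rightarrow> 0\<close>. Time
  inversion is proved for finite-dimensional marginals directly from the transition kernels: both
  processes step from a time to an earlier one by the same Brownian-bridge kernel.\<close>

section \<open>Transitions of the Wiener process\<close>

text \<open>Nothing links the processes \<open>W1 T\<close>, \<open>W2 T\<close> for different T, so
  no convergence along paths is available. Each T is instead compared in law with the one fixed pair
  \<open>B1\<close>, \<open>B2\<close>, through band events |W_i(x)| \<le> h(x), whose probabilities
  time inversion carries over exactly. Two barriers for \<open>B1\<close>, \<open>B2\<close> on
  [2n/T, 1] suffice: a constant a, which gives the distribution function of the maximum, and the
  line \<epsilon>(T/n)u, which for \<open>W1 T\<close>, \<open>W2 T\<close> says that sqrt n |W_i|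
  \<le> \<epsilon>T on [n, T/2]. The second one makes the far average negligible. It is likely
  because a continuous path starting at 0 lies under some line \<epsilon>(1 + mu), and T/n outgrows
  every fixed m. Inversion is applied only on [2n/T, 1], so continuity of the inverted process at 0
  is never at issue. Laws are compared through nonnegative integrals of products of one-variable
  functions: Fubini then asks for measurability only, and band events over rational times are limits
  of such products of indicators.\<close>

text \<open>Fubini on the product law, with the second variable integrated out against its density.
  The map \<open>g\<close> is present because splitting a family of independent increments yields
  function-valued restrictions; \<open>g\<close> reads off the single value of the restriction to
  one index.\<close>

lemma (in prob_space) nn_integral_indep_pair:
  assumes ind: "indep_var A X B Z" and g: "g \<in> borel_measurable B"
    and Y: "distributed M lborel (\<lambda>\<omega>. g (Z \<omega>)) f"
    and H: "H \<in> borel_measurable (A \<Otimes>\<^sub>M borel)"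
  shows "(\<integral>\<^sup>+\<omega>. H (X \<omega>, g (Z \<omega>)) \<partial>M) = (\<integral>\<^sup>+\<omega>. (\<integral>\<^sup>+y. f y * H (X \<omega>, y) \<partial>lborel) \<partial>M)"
proof -
  note rv1 [measurable] = indep_var_rv1[OF ind] and rv2 [measurable] = indep_var_rv2[OF ind]
  note H [measurable] and g [measurable]
  interpret Z: prob_space "distr M B Z" by (rule prob_space_distr) simp
  let ?H = "\<lambda>p. H (fst p, g (snd p))"
  have "(\<integral>\<^sup>+\<omega>. H (X \<omega>, g (Z \<omega>)) \<partial>M) = (\<integral>\<^sup>+p. ?H p \<partial>distr M (A \<Otimes>\<^sub>M B) (\<lambda>\<omega>. (X \<omega>, Z \<omega>)))"
    by (subst nn_integral_distr) simp_all
  also have "\<dots> = (\<integral>\<^sup>+p. ?H p \<partial>(distr M A X \<Otimes>\<^sub>M distr M B Z))"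
    using ind by (simp add: indep_var_distribution_eq)
  also have "\<dots> = (\<integral>\<^sup>+x. \<integral>\<^sup>+y. ?H (x, y) \<partial>distr M B Z \<partial>distr M A X)"
    by (rule Z.nn_integral_fst [symmetric]) simp
  also have "\<dots> = (\<integral>\<^sup>+\<omega>. \<integral>\<^sup>+y. ?H (X \<omega>, y) \<partial>distr M B Z \<partial>M)"
    by (subst nn_integral_distr) simp_all
  also have "\<dots> = (\<integral>\<^sup>+\<omega>. (\<integral>\<^sup>+y. f y * H (X \<omega>, y) \<partial>lborel) \<partial>M)"
  proof (rule nn_integral_cong)
    fix \<omega> assume "\<omega> \<in> space M"
    then have [measurable]: "(\<lambda>y. H (X \<omega>, y)) \<in> borel_measurable borel"
      using measurable_space[OF rv1] by measurable
    have "(\<integral>\<^sup>+y. ?H (X \<omega>, y) \<partial>distr M B Z) = (\<integral>\<^sup>+\<omega>'. H (X \<omega>, g (Z \<omega>')) \<partial>M)"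
      by (subst nn_integral_distr) simp_all
    also have "\<dots> = (\<integral>\<^sup>+y. f y * H (X \<omega>, y) \<partial>lborel)"
      by (rule distributed_nn_integral [OF Y, symmetric]) simp
    finally show "(\<integral>\<^sup>+y. ?H (X \<omega>, y) \<partial>distr M B Z) = (\<integral>\<^sup>+y. f y * H (X \<omega>, y) \<partial>lborel)" .
  qed
  finally show ?thesis .
qed

text \<open>The independence clause of \<open>wiener_on\<close> speaks of indexed increasing times,
  whereas the marginals are indexed by finite sets. Appending \<open>t\<close> as the last point
  makes increment number \<open>m\<close> the one from \<open>Max F\<close> to
  \<open>t\<close>.\<close>

lemma finite_chain_enumeration:
  fixes F :: "real set"
  assumes "finite F" "F \<noteq> {}" "Max F < t"
  obtains ts m where "\<And>i. i < Suc m \<Longrightarrow> ts i < ts (Suc i)" "ts ` {..m} = F"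
    "ts 0 = Min F" "ts m = Max F" "ts (Suc m) = (t::real)"
proof -
  define xs where "xs = sorted_list_of_set F"
  have xs: "sorted_wrt (<) xs" "set xs = F" "xs \<noteq> []"
    using assms by (auto simp: xs_def)
  define m where "m = length xs - 1"
  have len: "length xs = Suc m" using xs(3) by (simp add: m_def)
  define ts where "ts i = (xs @ [t]) ! i" for i
  have lt: "ts i < ts j" if "i < j" "j \<le> m" for i j
    using that xs(1) len by (auto simp: ts_def nth_append sorted_wrt_iff_nth_less)
  have img: "ts ` {..m} = F"
    using len by (auto simp: ts_def nth_append xs(2)[symmetric] set_conv_nth less_Suc_eq_le image_def)
  have m: "ts m = Max F"
  proof (rule Max_eqI [symmetric])
    fix y assume "y \<in> F"
    then obtain i where "i \<le> m" "y = ts i" using img by auto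
    then show "y \<le> ts m" using lt[of i m] by (cases "i = m") auto
  qed (use assms img in auto)
  have z: "ts 0 = Min F"
  proof (rule Min_eqI [symmetric])
    fix y assume "y \<in> F"
    then obtain i where "i \<le> m" "y = ts i" using img by auto
    then show "ts 0 \<le> y" using lt[of 0 i] by (cases "i = 0") auto
  qed (use assms img in auto)
  have S: "ts (Suc m) = t" by (simp add: ts_def nth_append len)
  have "ts i < ts (Suc i)" if "i < Suc m" for i
  proof (cases "i = m")
    case True then show ?thesis using S m assms by simp
  next
    case False then show ?thesis using that lt[of i "Suc i"] by simp
  qed
  then show thesis using that img z m S by blast
qed

lemma wiener_onD:
  assumes "wiener_on M L W"
  shows wiener_on_measurable: "\<And>t. t \<in> {0..L} \<Longrightarrow> W t \<in> borel_measurable M"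
    and wiener_on_zero: "\<And>\<omega>. \<omega> \<in> space M \<Longrightarrow> W 0 \<omega> = 0"
    and wiener_on_continuous: "\<And>\<omega>. \<omega> \<in> space M \<Longrightarrow> continuous_on {0..L} (\<lambda>t. W t \<omega>)"
    and wiener_on_increment: "\<And>s t. 0 \<le> s \<Longrightarrow> s < t \<Longrightarrow> t \<le> L \<Longrightarrow>
        distributed M lborel (\<lambda>\<omega>. W t \<omega> - W s \<omega>) (\<lambda>x. ennreal (normal_density 0 (sqrt (t - s)) x))"
    and wiener_on_indep: "\<And>n ts. (\<And>i. i \<le> n \<Longrightarrow> 0 \<le> ts i \<and> ts i \<le> L) \<Longrightarrow> (\<And>i. i < n \<Longrightarrow> ts i < ts (Suc i)) \<Longrightarrow>
        prob_space.indep_vars M (\<lambda>_. borel) (\<lambda>i \<omega>. W (ts (Suc i)) \<omega> - W (ts i) \<omega>) {..<n::nat}"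
  using assms unfolding wiener_on_def by blast+

text \<open>The Markov property tested on products: the past up to \<open>r\<close> is a function of
  increments before \<open>r\<close>, and the increment from \<open>r\<close> to \<open>t\<close> is
  independent of them and normal.\<close>

lemma wiener_step:
  fixes f :: "real \<Rightarrow> real \<Rightarrow> ennreal" and \<phi> :: "real \<Rightarrow> ennreal"
  assumes M: "prob_space M" and W: "wiener_on M L W"
    and F: "finite F" "F \<subseteq> {0..r}" and rt: "0 \<le> r" "r < t" "t \<le> L"
    and f [measurable]: "\<And>s. f s \<in> borel_measurable borel"
    and \<phi> [measurable]: "\<phi> \<in> borel_measurable borel"
  shows "(\<integral>\<^sup>+\<omega>. (\<Prod>s\<in>F. f s (W s \<omega>)) * \<phi> (W t \<omega>) \<partial>M) =
    (\<integral>\<^sup>+\<omega>. (\<Prod>s\<in>F. f s (W s \<omega>)) *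
       (\<integral>\<^sup>+z. ennreal (normal_density (W r \<omega>) (sqrt (t - r)) z) * \<phi> z \<partial>lborel) \<partial>M)"
proof -
  interpret prob_space M by fact
  \<comment> \<open>The time 0 turns values of \<open>W\<close> into telescoping sums of increments,
    since \<open>W 0\<close> vanishes; the time \<open>r\<close> makes the last increment equal to
    \<open>W t - W r\<close>.\<close>
  define F' where "F' = insert 0 (insert r F)"
  have F': "finite F'" "F' \<noteq> {}" "Max F' = r" "Min F' = 0"
  proof -
    show "Max F' = r" unfolding F'_def by (rule Max_eqI) (use F rt in auto)
    show "Min F' = 0" unfolding F'_def by (rule Min_eqI) (use F rt in auto)
  qed (use F in \<open>auto simp: F'_def\<close>)
  obtain ts m where ts: "\<And>i. i < Suc m \<Longrightarrow> ts i < ts (Suc i)" "ts ` {..m} = F'"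
    "ts 0 = 0" "ts m = r" "ts (Suc m) = t"
    using finite_chain_enumeration[of F' t] F' rt by metis
  define \<Delta> where "\<Delta> i \<omega> = W (ts (Suc i)) \<omega> - W (ts i) \<omega>" for i \<omega>
  have F'sub: "F' \<subseteq> {0..r}" using F rt by (auto simp: F'_def)
  have rng: "0 \<le> ts i \<and> ts i \<le> L" if "i \<le> Suc m" for i
  proof (cases "i = Suc m")
    case True then show ?thesis using ts rt by simp
  next
    case False
    then have "ts i \<in> F'" using ts(2) that by auto
    then show ?thesis using F'sub rt by fastforce
  qed
  have ind0: "indep_vars (\<lambda>_. borel) \<Delta> {..<Suc m}"
    unfolding \<Delta>_def by (rule wiener_on_indep[OF W]) (use rng ts in auto)
  have ind: "indep_var (Pi\<^sub>M {..<m} (\<lambda>_. borel)) (\<lambda>\<omega>. restrict (\<lambda>i. \<Delta> i \<omega>) {..<m})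
     (Pi\<^sub>M {m} (\<lambda>_. borel)) (\<lambda>\<omega>. restrict (\<lambda>i. \<Delta> i \<omega>) {m})"
    by (rule indep_var_restrict[OF ind0]) auto
  have dist: "distributed M lborel (\<lambda>\<omega>. restrict (\<lambda>i. \<Delta> i \<omega>) {m} m) (\<lambda>x. ennreal (normal_density 0 (sqrt (t - r)) x))"
    using wiener_on_increment[OF W rt] ts by (simp add: \<Delta>_def[abs_def])
  have "\<forall>s\<in>F'. \<exists>i\<le>m. ts i = s" using ts(2) by auto
  then obtain idx where idx: "\<And>s. s \<in> F' \<Longrightarrow> idx s \<le> m" "\<And>s. s \<in> F' \<Longrightarrow> ts (idx s) = s"
    by metis
  have Wsum: "W (ts i) \<omega> = (\<Sum>j<i. restrict (\<lambda>i. \<Delta> i \<omega>) {..<m} j)" if "\<omega> \<in> space M" "i \<le> m" for i \<omega>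
  proof -
    have "(\<Sum>j<i. restrict (\<lambda>i. \<Delta> i \<omega>) {..<m} j) = (\<Sum>j<i. \<Delta> j \<omega>)"
      using that by (intro sum.cong) auto
    also have "\<dots> = W (ts i) \<omega> - W (ts 0) \<omega>"
      unfolding \<Delta>_def by (rule sum_lessThan_telescope)
    finally show ?thesis using that wiener_on_zero[OF W] ts(3) by simp
  qed
  \<comment> \<open>\<open>P\<close> and \<open>G\<close> rebuild the product over \<open>F\<close>
    and the value \<open>W r\<close> from the vector of increments before \<open>r\<close>, so that
    independence of that vector from the last increment can be used.\<close>
  define P :: "(nat \<Rightarrow> real) \<Rightarrow> ennreal" where "P p = (\<Prod>s\<in>F. f s (\<Sum>j<idx s. p j))" for p
  define G :: "(nat \<Rightarrow> real) \<Rightarrow> real" where "G p = (\<Sum>j<m. p j)" for p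
  define R where "R \<omega> = restrict (\<lambda>i. \<Delta> i \<omega>) {..<m}" for \<omega>
  have cm: "(\<lambda>p. p j) \<in> borel_measurable (Pi\<^sub>M {..<m} (\<lambda>_. borel))" if "j < m" for j
    using that by (intro measurable_component_singleton) auto
  have [measurable]: "G \<in> borel_measurable (Pi\<^sub>M {..<m} (\<lambda>_. borel))"
    unfolding G_def[abs_def] by (intro borel_measurable_sum cm) auto
  have [measurable]: "P \<in> borel_measurable (Pi\<^sub>M {..<m} (\<lambda>_. borel))"
    unfolding P_def[abs_def]
  proof (intro borel_measurable_prod_ennreal measurable_compose[OF _ f] borel_measurable_sum cm)
    fix s j assume "s \<in> F" "j \<in> {..<idx s}"
    then show "j < m" using idx(1)[of s] by (auto simp: F'_def)
  qed
  have PR: "P (R \<omega>) = (\<Prod>s\<in>F. f s (W s \<omega>))" if "\<omega> \<in> space M" for \<omega>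
    unfolding P_def R_def
  proof (rule prod.cong)
    fix s assume "s \<in> F"
    then have "s \<in> F'" by (simp add: F'_def)
    then show "f s (\<Sum>j<idx s. restrict (\<lambda>i. \<Delta> i \<omega>) {..<m} j) = f s (W s \<omega>)"
      using Wsum[OF that idx(1)] idx(2) by metis
  qed simp
  have GR: "G (R \<omega>) = W r \<omega>" if "\<omega> \<in> space M" for \<omega>
    using Wsum[OF that, of m] ts(4) by (simp add: G_def R_def)
  have Wt: "W t \<omega> = W r \<omega> + \<Delta> m \<omega>" for \<omega> using ts by (simp add: \<Delta>_def)
  have "(\<integral>\<^sup>+\<omega>. (\<Prod>s\<in>F. f s (W s \<omega>)) * \<phi> (W t \<omega>) \<partial>M) =
     (\<integral>\<^sup>+\<omega>. (\<lambda>(p, d). P p * \<phi> (G p + d)) (R \<omega>, restrict (\<lambda>i. \<Delta> i \<omega>) {m} m) \<partial>M)"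
    by (rule nn_integral_cong) (simp add: PR GR Wt)
  also have "\<dots> = (\<integral>\<^sup>+\<omega>. (\<integral>\<^sup>+y. ennreal (normal_density 0 (sqrt (t - r)) y) *
       (\<lambda>(p, d). P p * \<phi> (G p + d)) (R \<omega>, y) \<partial>lborel) \<partial>M)"
    unfolding R_def by (rule nn_integral_indep_pair[where g="\<lambda>x. x m", OF ind _ dist]) measurable
  also have "\<dots> = (\<integral>\<^sup>+\<omega>. (\<Prod>s\<in>F. f s (W s \<omega>)) *
       (\<integral>\<^sup>+z. ennreal (normal_density (W r \<omega>) (sqrt (t - r)) z) * \<phi> z \<partial>lborel) \<partial>M)"
  proof (rule nn_integral_cong)
    fix \<omega> assume \<omega>: "\<omega> \<in> space M"
    have "(\<integral>\<^sup>+y. ennreal (normal_density 0 (sqrt (t - r)) y) * (P (R \<omega>) * \<phi> (G (R \<omega>) + y)) \<partial>lborel) =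
       P (R \<omega>) * (\<integral>\<^sup>+y. ennreal (normal_density 0 (sqrt (t - r)) y) * \<phi> (W r \<omega> + y) \<partial>lborel)"
      by (subst nn_integral_cmult[symmetric]) (auto simp: GR[OF \<omega>] mult_ac)
    also have "(\<integral>\<^sup>+y. ennreal (normal_density 0 (sqrt (t - r)) y) * \<phi> (W r \<omega> + y) \<partial>lborel) =
       (\<integral>\<^sup>+y. ennreal (normal_density 0 (sqrt (t - r)) (y - W r \<omega>)) * \<phi> y \<partial>lborel)"
      by (subst nn_integral_real_affine[where c=1 and t="W r \<omega>"
            and f="\<lambda>y. ennreal (normal_density 0 (sqrt (t - r)) (y - W r \<omega>)) * \<phi> y"]) auto
    also have "\<dots> = (\<integral>\<^sup>+z. ennreal (normal_density (W r \<omega>) (sqrt (t - r)) z) * \<phi> z \<partial>lborel)"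
      by (simp add: normal_density_def)
    finally show "(\<integral>\<^sup>+y. ennreal (normal_density 0 (sqrt (t - r)) y) *
       (\<lambda>(p, d). P p * \<phi> (G p + d)) (R \<omega>, y) \<partial>lborel) = (\<Prod>s\<in>F. f s (W s \<omega>)) *
       (\<integral>\<^sup>+z. ennreal (normal_density (W r \<omega>) (sqrt (t - r)) z) * \<phi> z \<partial>lborel)"
      by (simp add: PR[OF \<omega>])
  qed
  finally show ?thesis .
qed

section \<open>The Brownian-bridge kernel and steps to earlier times\<close>

text \<open>Two factorizations of the joint density of a Wiener process at times \<open>u\<close>
  and \<open>v\<close>: forwards from \<open>u\<close>, and backwards from \<open>v\<close>.
  Completing the square in \<open>y\<close> shows that the backward factor is the Brownian bridge,
  with mean \<open>u / v * x\<close> and variance \<open>u * (v - u) / v\<close>.\<close>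

lemma normal_density_bridge:
  assumes "0 < u" "u < v"
  shows "normal_density 0 (sqrt u) y * normal_density y (sqrt (v - u)) x =
    normal_density 0 (sqrt v) x * normal_density (u / v * x) (sqrt (u * (v - u) / v)) y"
proof -
  have v: "0 < v" and d: "0 < v - u" and q: "0 < u * (v - u) / v"
    using assms by (auto intro!: divide_pos_pos mult_pos_pos)
  have pre: "sqrt (2 * pi * u) * sqrt (2 * pi * (v - u)) = sqrt (2 * pi * v) * sqrt (2 * pi * (u * (v - u) / v))"
    using v by (simp add: real_sqrt_mult[symmetric] mult_ac)
  have ex: "- (y - 0)\<^sup>2 / (2 * u) + - (x - y)\<^sup>2 / (2 * (v - u)) =
      - (x - 0)\<^sup>2 / (2 * v) + - (y - u / v * x)\<^sup>2 / (2 * (u * (v - u) / v))"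
  proof -
    have "(y - u / v * x)\<^sup>2 / (2 * (u * (v - u) / v)) = (v * y - u * x)\<^sup>2 / (2 * u * (v - u) * v)"
    proof -
      have "y - u / v * x = (v * y - u * x) / v" using v by (simp add: field_simps)
      then show ?thesis using v d assms by (simp add: power_divide power2_eq_square)
    qed
    moreover have "y\<^sup>2 / (2 * u) + (x - y)\<^sup>2 / (2 * (v - u)) - x\<^sup>2 / (2 * v) =
        (y\<^sup>2 * (v - u) * v + (x - y)\<^sup>2 * u * v - x\<^sup>2 * u * (v - u)) / (2 * u * (v - u) * v)"
      using v d assms by (simp add: add_divide_distrib diff_divide_distrib)
    moreover have "y\<^sup>2 * (v - u) * v + (x - y)\<^sup>2 * u * v - x\<^sup>2 * u * (v - u) = (v * y - u * x)\<^sup>2"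
      by (simp add: power2_eq_square algebra_simps)
    ultimately show ?thesis by (simp add: algebra_simps)
  qed
  have "normal_density 0 (sqrt u) y * normal_density y (sqrt (v - u)) x =
     exp (- (y - 0)\<^sup>2 / (2 * u) + - (x - y)\<^sup>2 / (2 * (v - u))) / (sqrt (2 * pi * u) * sqrt (2 * pi * (v - u)))"
    unfolding exp_add using assms d by (simp add: normal_density_def)
  also have "\<dots> = normal_density 0 (sqrt v) x * normal_density (u / v * x) (sqrt (u * (v - u) / v)) y"
    unfolding pre ex exp_add using v q by (simp add: normal_density_def)
  finally show ?thesis .
qed

lemma nn_integral_normal_density_scale:
  fixes \<phi> :: "real \<Rightarrow> ennreal"
  assumes k: "0 < k" and s: "0 < s" and \<phi> [measurable]: "\<phi> \<in> borel_measurable borel"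
  shows "(\<integral>\<^sup>+z. ennreal (normal_density m s z) * \<phi> (k * z) \<partial>lborel) =
    (\<integral>\<^sup>+z. ennreal (normal_density (k * m) (k * s) z) * \<phi> z \<partial>lborel)"
proof -
  have nd: "k * normal_density (k * m) (k * s) (k * z) = normal_density m s z" for z
  proof -
    have "(k * z - k * m)\<^sup>2 / (2 * (k * s)\<^sup>2) = (z - m)\<^sup>2 / (2 * s\<^sup>2)"
      using k by (simp add: right_diff_distrib[symmetric] power_mult_distrib)
    moreover have "sqrt (2 * pi * (k * s)\<^sup>2) = k * sqrt (2 * pi * s\<^sup>2)"
      using k by (simp add: power_mult_distrib real_sqrt_mult)
    ultimately show ?thesis using k by (simp add: normal_density_def)
  qed
  have "(\<integral>\<^sup>+z. ennreal (normal_density (k * m) (k * s) z) * \<phi> z \<partial>lborel) =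
     ennreal \<bar>k\<bar> * (\<integral>\<^sup>+z. ennreal (normal_density (k * m) (k * s) (0 + k * z)) * \<phi> (0 + k * z) \<partial>lborel)"
    by (rule nn_integral_real_affine) (use k in auto)
  also have "\<dots> = (\<integral>\<^sup>+z. ennreal (k * normal_density (k * m) (k * s) (k * z)) * \<phi> (k * z) \<partial>lborel)"
    using k by (subst nn_integral_cmult[symmetric]) (auto simp: ennreal_mult mult_ac)
  finally show ?thesis by (simp add: nd)
qed

lemma wiener_marginal:
  fixes \<phi> :: "real \<Rightarrow> ennreal"
  assumes M: "prob_space M" and W: "wiener_on M L W" and t: "0 < t" "t \<le> L"
    and \<phi> [measurable]: "\<phi> \<in> borel_measurable borel"
  shows "(\<integral>\<^sup>+\<omega>. \<phi> (W t \<omega>) \<partial>M) = (\<integral>\<^sup>+z. ennreal (normal_density 0 (sqrt t) z) * \<phi> z \<partial>lborel)"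
proof -
  interpret prob_space M by fact
  have "(\<integral>\<^sup>+\<omega>. \<phi> (W t \<omega>) \<partial>M) =
    (\<integral>\<^sup>+\<omega>. (\<integral>\<^sup>+z. ennreal (normal_density (W 0 \<omega>) (sqrt t) z) * \<phi> z \<partial>lborel) \<partial>M)"
    using wiener_step[OF M W, of "{}" 0 t "\<lambda>_ _. 0" \<phi>] t by simp
  also have "\<dots> = (\<integral>\<^sup>+\<omega>. (\<integral>\<^sup>+z. ennreal (normal_density 0 (sqrt t) z) * \<phi> z \<partial>lborel) \<partial>M)"
    by (rule nn_integral_cong) (simp add: wiener_on_zero[OF W])
  finally show ?thesis by (simp add: emeasure_space_1)
qed

text \<open>This is the classical inversion u W'(1/u) of the rescaled process W'(s) = W(c s)/sqrt c.
  It maps the times [c, L] of \<open>W\<close> to [c/L, 1], which is where it is used.\<close>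

definition time_inversion :: "real \<Rightarrow> (real \<Rightarrow> 'a \<Rightarrow> real) \<Rightarrow> real \<Rightarrow> 'a \<Rightarrow> real" where
  "time_inversion c W u \<omega> = u / sqrt c * W (c / u) \<omega>"

text \<open>Inversion reverses time: the times v \<ge> b of \<open>Y\<close> are the times c/v \<le>
  c/b of \<open>W\<close>, so going down from b to a is a forward step of \<open>W\<close> from c/b
  to c/a. Multiplying the normal step by a / sqrt c gives mean (a/b) Y b and variance (a^2/c)(c/a -
  c/b) = a(b - a)/b, which is the bridge kernel.\<close>

lemma time_inversion_step:
  fixes f :: "real \<Rightarrow> real \<Rightarrow> ennreal" and \<phi> :: "real \<Rightarrow> ennreal"
  assumes M: "prob_space M" and W: "wiener_on M L W"
    and c: "0 < c" "c \<le> L"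
    and V: "finite V" "V \<subseteq> {b..}" and ab: "c / L \<le> a" "a < b"
    and f [measurable]: "\<And>s. f s \<in> borel_measurable borel"
    and \<phi> [measurable]: "\<phi> \<in> borel_measurable borel"
  defines "Y \<equiv> time_inversion c W"
  shows "(\<integral>\<^sup>+\<omega>. (\<Prod>v\<in>V. f v (Y v \<omega>)) * \<phi> (Y a \<omega>) \<partial>M) =
    (\<integral>\<^sup>+\<omega>. (\<Prod>v\<in>V. f v (Y v \<omega>)) *
       (\<integral>\<^sup>+y. ennreal (normal_density (a / b * Y b \<omega>) (sqrt (a * (b - a) / b)) y) * \<phi> y \<partial>lborel) \<partial>M)"
proof -
  have a: "0 < a" using ab(1) c by (meson divide_pos_pos less_le_trans)
  have b: "0 < b" using a ab by simp
  have inj: "inj_on ((/) c) V" using c V b by (auto simp: inj_on_def)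
  have re: "(\<Prod>s\<in>(/) c ` V. f (c / s) (c / s / sqrt c * W s \<omega>)) = (\<Prod>v\<in>V. f v (Y v \<omega>))" for \<omega>
    using c by (subst prod.reindex[OF inj]) (simp add: Y_def time_inversion_def mult_ac)
  have [measurable]: "(\<lambda>x. f (c / s) (c / s / sqrt c * x)) \<in> borel_measurable borel" for s
    by (rule measurable_compose[OF _ f]) measurable
  have "(\<integral>\<^sup>+\<omega>. (\<Prod>s\<in>(/) c ` V. f (c / s) (c / s / sqrt c * W s \<omega>)) * \<phi> (a / sqrt c * W (c / a) \<omega>) \<partial>M) =
    (\<integral>\<^sup>+\<omega>. (\<Prod>s\<in>(/) c ` V. f (c / s) (c / s / sqrt c * W s \<omega>)) *
       (\<integral>\<^sup>+z. ennreal (normal_density (W (c / b) \<omega>) (sqrt (c / a - c / b)) z) * \<phi> (a / sqrt c * z) \<partial>lborel) \<partial>M)"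
  proof (rule wiener_step[OF M W, where f="\<lambda>s x. f (c / s) (c / s / sqrt c * x)" and \<phi>="\<lambda>x. \<phi> (a / sqrt c * x)"])
    show "c / b < c / a" using a b ab c by (simp add: divide_strict_left_mono)
    show "c / a \<le> L" using a ab c by (simp add: field_simps)
    show "(/) c ` V \<subseteq> {0..c / b}"
      using V b c by (auto intro!: divide_left_mono mult_pos_pos dest!: subsetD)
  qed (use V b c in auto)
  also have "(\<lambda>\<omega>. \<integral>\<^sup>+z. ennreal (normal_density (W (c / b) \<omega>) (sqrt (c / a - c / b)) z) * \<phi> (a / sqrt c * z) \<partial>lborel) =
    (\<lambda>\<omega>. \<integral>\<^sup>+y. ennreal (normal_density (a / b * Y b \<omega>) (sqrt (a * (b - a) / b)) y) * \<phi> y \<partial>lborel)"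
  proof
    fix \<omega>
    have "a / sqrt c * sqrt (c / a - c / b) = sqrt (a * (b - a) / b)"
    proof -
      have "a / sqrt c * sqrt (c / a - c / b) = sqrt (a\<^sup>2 / c * (c / a - c / b))"
        using a by (simp add: real_sqrt_mult real_sqrt_divide)
      also have "a\<^sup>2 / c * (c / a - c / b) = a * (b - a) / b"
        using a b c by (simp add: field_simps power2_eq_square)
      finally show ?thesis .
    qed
    moreover have "a / sqrt c * W (c / b) \<omega> = a / b * Y b \<omega>"
      using b by (simp add: Y_def time_inversion_def)
    moreover have "0 < c / a - c / b" using a b ab c by (simp add: divide_strict_left_mono)
    ultimately show "(\<integral>\<^sup>+z. ennreal (normal_density (W (c / b) \<omega>) (sqrt (c / a - c / b)) z) * \<phi> (a / sqrt c * z) \<partial>lborel) =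
      (\<integral>\<^sup>+y. ennreal (normal_density (a / b * Y b \<omega>) (sqrt (a * (b - a) / b)) y) * \<phi> y \<partial>lborel)"
      using nn_integral_normal_density_scale[of "a / sqrt c" "sqrt (c / a - c / b)" \<phi> "W (c / b) \<omega>"] a c
      by simp
  qed
  finally show ?thesis by (simp only: re) (simp add: Y_def time_inversion_def)
qed

lemma time_inversion_marginal:
  fixes \<phi> :: "real \<Rightarrow> ennreal"
  assumes M: "prob_space M" and W: "wiener_on M L W" and c: "0 < c" "c \<le> L" and a: "c / L \<le> a"
    and \<phi> [measurable]: "\<phi> \<in> borel_measurable borel"
  shows "(\<integral>\<^sup>+\<omega>. \<phi> (time_inversion c W a \<omega>) \<partial>M) =
    (\<integral>\<^sup>+z. ennreal (normal_density 0 (sqrt a) z) * \<phi> z \<partial>lborel)"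
proof -
  have a0: "0 < a" using a c by (meson divide_pos_pos less_le_trans)
  have "(\<integral>\<^sup>+\<omega>. \<phi> (a / sqrt c * W (c / a) \<omega>) \<partial>M) =
     (\<integral>\<^sup>+z. ennreal (normal_density 0 (sqrt (c / a)) z) * \<phi> (a / sqrt c * z) \<partial>lborel)"
    using a a0 c by (intro wiener_marginal[OF M W, where \<phi>="\<lambda>x. \<phi> (a / sqrt c * x)"]) (auto simp: field_simps)
  also have "\<dots> = (\<integral>\<^sup>+z. ennreal (normal_density (a / sqrt c * 0) (a / sqrt c * sqrt (c / a)) z) * \<phi> z \<partial>lborel)"
    using a0 c by (intro nn_integral_normal_density_scale) auto
  also have "a / sqrt c * sqrt (c / a) = sqrt a"
    using a0 c by (simp add: real_sqrt_divide real_div_sqrt)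
  finally show ?thesis by (simp add: time_inversion_def)
qed

text \<open>Reads the Wiener process backwards: given \<open>W b\<close>, the earlier value
  \<open>W a\<close> follows the same kernel that \<open>time_inversion_step\<close> finds for the
  inverted process.\<close>

lemma wiener_bridge_step:
  fixes H \<phi> :: "real \<Rightarrow> ennreal"
  assumes M: "prob_space M" and W: "wiener_on M L W" and ab: "0 < a" "a < b" "b \<le> L"
    and H [measurable]: "H \<in> borel_measurable borel" and \<phi> [measurable]: "\<phi> \<in> borel_measurable borel"
  shows "(\<integral>\<^sup>+\<omega>. H (W a \<omega>) * \<phi> (W b \<omega>) \<partial>M) =
    (\<integral>\<^sup>+\<omega>. (\<integral>\<^sup>+y. ennreal (normal_density (a / b * W b \<omega>) (sqrt (a * (b - a) / b)) y) * H y \<partial>lborel) * \<phi> (W b \<omega>) \<partial>M)"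
proof -
  have nm: "(\<lambda>p. normal_density (r * fst p) s (snd p)) \<in> borel_measurable (borel \<Otimes>\<^sub>M borel)" for r s
    unfolding normal_density_def by measurable
  have [measurable]: "(\<lambda>(x, y). normal_density (r * x) s y) \<in> borel_measurable (borel \<Otimes>\<^sub>M borel)" for r s
    using nm[of r s] by (simp add: case_prod_unfold)
  have [measurable]: "(\<lambda>(x, y). normal_density x s y) \<in> borel_measurable (borel \<Otimes>\<^sub>M borel)" for s
    using nm[of 1 s] by (simp add: case_prod_unfold)
  have "(\<integral>\<^sup>+\<omega>. H (W a \<omega>) * \<phi> (W b \<omega>) \<partial>M) =
    (\<integral>\<^sup>+\<omega>. H (W a \<omega>) * (\<integral>\<^sup>+x. ennreal (normal_density (W a \<omega>) (sqrt (b - a)) x) * \<phi> x \<partial>lborel) \<partial>M)"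
    using wiener_step[OF M W, of "{a}" a b "\<lambda>_. H" \<phi>] ab by simp
  also have "\<dots> = (\<integral>\<^sup>+y. ennreal (normal_density 0 (sqrt a) y) *
      (H y * (\<integral>\<^sup>+x. ennreal (normal_density y (sqrt (b - a)) x) * \<phi> x \<partial>lborel)) \<partial>lborel)"
    using ab by (intro wiener_marginal[OF M W,
          where \<phi>="\<lambda>y. H y * (\<integral>\<^sup>+x. ennreal (normal_density y (sqrt (b - a)) x) * \<phi> x \<partial>lborel)"]) auto
  also have "\<dots> = (\<integral>\<^sup>+y. \<integral>\<^sup>+x. ennreal (normal_density 0 (sqrt a) y * normal_density y (sqrt (b - a)) x) *
      (H y * \<phi> x) \<partial>lborel \<partial>lborel)"
    by (simp add: nn_integral_cmult[symmetric] ennreal_mult mult_ac)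
  \<comment> \<open>The forward factorization of the joint density is exchanged for the backward
    one; Fubini then makes the later value the outer variable.\<close>
  also have "\<dots> = (\<integral>\<^sup>+y. \<integral>\<^sup>+x. ennreal (normal_density 0 (sqrt b) x * normal_density (a / b * x) (sqrt (a * (b - a) / b)) y) *
      (H y * \<phi> x) \<partial>lborel \<partial>lborel)"
    using ab by (simp only: normal_density_bridge)
  also have "\<dots> = (\<integral>\<^sup>+x. \<integral>\<^sup>+y. ennreal (normal_density 0 (sqrt b) x * normal_density (a / b * x) (sqrt (a * (b - a) / b)) y) *
      (H y * \<phi> x) \<partial>lborel \<partial>lborel)"
    by (rule lborel_pair.Fubini') measurable
  also have "\<dots> = (\<integral>\<^sup>+x. ennreal (normal_density 0 (sqrt b) x) *
      ((\<integral>\<^sup>+y. ennreal (normal_density (a / b * x) (sqrt (a * (b - a) / b)) y) * H y \<partial>lborel) * \<phi> x) \<partial>lborel)"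
    by (simp add: nn_integral_cmult[symmetric] nn_integral_multc[symmetric] ennreal_mult mult_ac)
  also have "\<dots> = (\<integral>\<^sup>+\<omega>. (\<integral>\<^sup>+y. ennreal (normal_density (a / b * W b \<omega>) (sqrt (a * (b - a) / b)) y) * H y \<partial>lborel) * \<phi> (W b \<omega>) \<partial>M)"
    using ab by (intro wiener_marginal[OF M W,
       where \<phi>="\<lambda>x. (\<integral>\<^sup>+y. ennreal (normal_density (a / b * x) (sqrt (a * (b - a) / b)) y) * H y \<partial>lborel) * \<phi> x", symmetric]) auto
  finally show ?thesis .
qed

section \<open>Time inversion\<close>

lemma measurable_bridge_integral:
  fixes H :: "real \<Rightarrow> ennreal"
  assumes [measurable]: "H \<in> borel_measurable borel"
  shows "(\<lambda>x. \<integral>\<^sup>+y. ennreal (normal_density (r * x) s y) * H y \<partial>lborel) \<in> borel_measurable borel"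
proof -
  have "(\<lambda>p. normal_density (r * fst p) s (snd p)) \<in> borel_measurable (borel \<Otimes>\<^sub>M borel)"
    unfolding normal_density_def by measurable
  then have [measurable]: "(\<lambda>(x, y). normal_density (r * x) s y) \<in> borel_measurable (borel \<Otimes>\<^sub>M borel)"
    by (simp add: case_prod_unfold)
  show ?thesis by measurable
qed

text \<open>The function \<open>H\<close> collects the times in \<open>U\<close>: it is built by integrating the
  Brownian-bridge kernel from the smallest time upwards, and the two processes share it because
  both have this bridge as their transition to an earlier time.\<close>
lemma time_inversion_common_kernel:
  fixes f :: "real \<Rightarrow> real \<Rightarrow> ennreal"
  assumes M: "prob_space M" and W: "wiener_on M L W"
    and N: "prob_space N" and B: "wiener_on N R B"
    and c: "0 < c" "c \<le> L"
    and f [measurable]: "\<And>s. f s \<in> borel_measurable borel"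
    and U: "finite U" "U \<noteq> {}" "U \<subseteq> {c / L..R}"
  defines "Y \<equiv> time_inversion c W"
  shows "\<exists>H\<in>borel_measurable borel.
     (\<forall>\<phi>\<in>borel_measurable borel.
        (\<integral>\<^sup>+\<omega>. (\<Prod>u\<in>U. f u (B u \<omega>)) * \<phi> (B (Max U) \<omega>) \<partial>N) =
        (\<integral>\<^sup>+\<omega>. H (B (Max U) \<omega>) * \<phi> (B (Max U) \<omega>) \<partial>N)) \<and>
     (\<forall>V. finite V \<longrightarrow> V \<subseteq> {Max U<..} \<longrightarrow>
        (\<integral>\<^sup>+\<omega>. (\<Prod>u\<in>U \<union> V. f u (Y u \<omega>)) \<partial>M) =
        (\<integral>\<^sup>+\<omega>. (\<Prod>u\<in>V. f u (Y u \<omega>)) * H (Y (Max U) \<omega>) \<partial>M))"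
  using U
proof (induction U rule: finite_linorder_max_induct)
  case empty
  then show ?case by simp
next
  case (insert b A)
  have maxb: "Max (insert b A) = b"
    using insert.hyps by (intro Max_eqI) auto
  have bA: "b \<notin> A" using insert.hyps by auto
  have b: "c / L \<le> b" "b \<le> R" using insert.prems by auto
  show ?case
  proof (cases "A = {}")
    case True
    have "(\<Prod>u\<in>insert b V. f u (Y u \<omega>)) = (\<Prod>u\<in>V. f u (Y u \<omega>)) * f b (Y b \<omega>)"
      if "finite V" "V \<subseteq> {b<..}" for V \<omega>
      using that by (subst prod.insert) (auto simp: mult_ac)
    then show ?thesis
      by (intro bexI[of _ "f b"]) (auto simp: True)
  next
    case False
    define a where "a = Max A"
    have aA: "a \<in> A" using False insert.hyps by (simp add: a_def)
    have ab: "a < b" using aA insert.hyps by auto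
    have a: "c / L \<le> a" using aA insert.prems by auto
    have a0: "0 < a" using a c by (meson divide_pos_pos less_le_trans)
    \<comment> \<open>The two clauses treat later times differently. For \<open>B\<close> a free
      test function at the maximum absorbs a forward step. The inverted process is only stepped
      downwards, conditionally on all later times, so these stay explicit as
      \<open>V\<close>.\<close>
    obtain H where [measurable]: "H \<in> borel_measurable borel"
      and HB: "\<And>\<phi>. \<phi> \<in> borel_measurable borel \<Longrightarrow>
        (\<integral>\<^sup>+\<omega>. (\<Prod>u\<in>A. f u (B u \<omega>)) * \<phi> (B a \<omega>) \<partial>N) =
        (\<integral>\<^sup>+\<omega>. H (B a \<omega>) * \<phi> (B a \<omega>) \<partial>N)"
      and HY: "\<And>V. finite V \<Longrightarrow> V \<subseteq> {a<..} \<Longrightarrow>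
        (\<integral>\<^sup>+\<omega>. (\<Prod>u\<in>A \<union> V. f u (Y u \<omega>)) \<partial>M) =
        (\<integral>\<^sup>+\<omega>. (\<Prod>u\<in>V. f u (Y u \<omega>)) * H (Y a \<omega>) \<partial>M)"
      using insert.IH False insert.prems unfolding a_def by auto
    \<comment> \<open>Averaging \<open>H\<close> over the bridge moves it from time \<open>a\<close>
      to time \<open>b\<close>; the new kernel function is then \<open>f b\<close> times
      \<open>K\<close>.\<close>
    define K where "K x = (\<integral>\<^sup>+y. ennreal (normal_density (a / b * x) (sqrt (a * (b - a) / b)) y) * H y \<partial>lborel)" for x
    have [measurable]: "K \<in> borel_measurable borel"
      unfolding K_def[abs_def] by (rule measurable_bridge_integral) simp
    have 1: "(\<integral>\<^sup>+\<omega>. (\<Prod>u\<in>insert b A. f u (B u \<omega>)) * \<phi> (B b \<omega>) \<partial>N) =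
        (\<integral>\<^sup>+\<omega>. f b (B b \<omega>) * K (B b \<omega>) * \<phi> (B b \<omega>) \<partial>N)"
      if [measurable]: "\<phi> \<in> borel_measurable borel" for \<phi>
    proof -
      have [measurable]: "(\<lambda>x. \<integral>\<^sup>+z. ennreal (normal_density x (sqrt (b - a)) z) * (f b z * \<phi> z) \<partial>lborel) \<in> borel_measurable borel"
        using measurable_bridge_integral[of "\<lambda>z. f b z * \<phi> z" 1] by simp
      have "(\<integral>\<^sup>+\<omega>. (\<Prod>u\<in>insert b A. f u (B u \<omega>)) * \<phi> (B b \<omega>) \<partial>N) =
         (\<integral>\<^sup>+\<omega>. (\<Prod>u\<in>A. f u (B u \<omega>)) * (f b (B b \<omega>) * \<phi> (B b \<omega>)) \<partial>N)"
        using bA insert.hyps by (simp add: mult_ac)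
      \<comment> \<open>\<open>B b\<close> is integrated out by a forward step, leaving a test
        function of \<open>B a\<close> to which the induction hypothesis applies. The same step read
        in reverse restores \<open>B b\<close>, and the bridge step then eliminates
        \<open>B a\<close>.\<close>
      also have "\<dots> = (\<integral>\<^sup>+\<omega>. (\<Prod>u\<in>A. f u (B u \<omega>)) *
          (\<integral>\<^sup>+z. ennreal (normal_density (B a \<omega>) (sqrt (b - a)) z) * (f b z * \<phi> z) \<partial>lborel) \<partial>N)"
      proof (rule wiener_step[OF N B, where \<phi>="\<lambda>x. f b x * \<phi> x"])
        have "0 \<le> u \<and> u \<le> a" if "u \<in> A" for u
        proof
          show "u \<le> a" using that insert.hyps by (simp add: a_def)
          have "c / L \<le> u" using that insert.prems by auto
          then show "0 \<le> u" using c by (meson divide_nonneg_nonneg less_imp_le order_trans)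
        qed
        then show "A \<subseteq> {0..a}" by auto
      qed (use insert.hyps a0 ab b in auto)
      also have "\<dots> = (\<integral>\<^sup>+\<omega>. H (B a \<omega>) *
          (\<integral>\<^sup>+z. ennreal (normal_density (B a \<omega>) (sqrt (b - a)) z) * (f b z * \<phi> z) \<partial>lborel) \<partial>N)"
        by (rule HB) measurable
      also have "\<dots> = (\<integral>\<^sup>+\<omega>. H (B a \<omega>) * (f b (B b \<omega>) * \<phi> (B b \<omega>)) \<partial>N)"
        using wiener_step[OF N B, of "{a}" a b "\<lambda>_. H" "\<lambda>x. f b x * \<phi> x"] a0 ab b by simp
      also have "\<dots> = (\<integral>\<^sup>+\<omega>. K (B b \<omega>) * (f b (B b \<omega>) * \<phi> (B b \<omega>)) \<partial>N)"
        unfolding K_def by (rule wiener_bridge_step[OF N B a0 ab b(2), where \<phi>="\<lambda>x. f b x * \<phi> x"]) measurable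
      finally show ?thesis by (simp add: mult_ac)
    qed
    have 2: "(\<integral>\<^sup>+\<omega>. (\<Prod>u\<in>insert b A \<union> V. f u (Y u \<omega>)) \<partial>M) =
        (\<integral>\<^sup>+\<omega>. (\<Prod>u\<in>V. f u (Y u \<omega>)) * (f b (Y b \<omega>) * K (Y b \<omega>)) \<partial>M)"
      if V: "finite V" "V \<subseteq> {b<..}" for V
    proof -
      have bV: "b \<notin> V" using V by auto
      have "(\<integral>\<^sup>+\<omega>. (\<Prod>u\<in>insert b A \<union> V. f u (Y u \<omega>)) \<partial>M) =
          (\<integral>\<^sup>+\<omega>. (\<Prod>u\<in>A \<union> insert b V. f u (Y u \<omega>)) \<partial>M)"
        by simp
      also have "\<dots> = (\<integral>\<^sup>+\<omega>. (\<Prod>u\<in>insert b V. f u (Y u \<omega>)) * H (Y a \<omega>) \<partial>M)"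
        by (rule HY) (use V ab in auto)
      also have "\<dots> = (\<integral>\<^sup>+\<omega>. (\<Prod>u\<in>insert b V. f u (Y u \<omega>)) * K (Y b \<omega>) \<partial>M)"
        unfolding K_def Y_def by (rule time_inversion_step[OF M W c _ _ a ab]) (use V in auto)
      finally show ?thesis using V bV by (simp add: mult_ac)
    qed
    have 3: "(\<lambda>x. f b x * K x) \<in> borel_measurable borel" by measurable
    show ?thesis unfolding maxb
      by (intro bexI[of _ "\<lambda>x. f b x * K x"] conjI ballI allI impI 1 2 3)
  qed
qed

text \<open>With test function 1 and no later times, both sides become the integral of the same
  \<open>H\<close> against the marginal at \<open>Max U\<close>, which is normal with variance
  \<open>Max U\<close> for both processes.\<close>

lemma time_inversion_same_law:
  fixes f :: "real \<Rightarrow> real \<Rightarrow> ennreal"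
  assumes M: "prob_space M" and W: "wiener_on M L W"
    and N: "prob_space N" and B: "wiener_on N R B"
    and c: "0 < c" "c \<le> L"
    and f [measurable]: "\<And>s. f s \<in> borel_measurable borel"
    and U: "finite U" "U \<subseteq> {c / L..R}"
  shows "(\<integral>\<^sup>+\<omega>. (\<Prod>u\<in>U. f u (time_inversion c W u \<omega>)) \<partial>M) = (\<integral>\<^sup>+\<omega>. (\<Prod>u\<in>U. f u (B u \<omega>)) \<partial>N)"
proof (cases "U = {}")
  case True
  then show ?thesis using prob_space.emeasure_space_1[OF M] prob_space.emeasure_space_1[OF N] by simp
next
  case False
  define a where "a = Max U"
  have "a \<in> U" using U False by (simp add: a_def)
  then have a: "c / L \<le> a" "a \<le> R" using U by auto
  have a0: "0 < a" using a(1) c by (meson divide_pos_pos less_le_trans)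
  obtain H where H: "H \<in> borel_measurable borel"
    and HB: "\<And>\<phi>. \<phi> \<in> borel_measurable borel \<Longrightarrow>
        (\<integral>\<^sup>+\<omega>. (\<Prod>u\<in>U. f u (B u \<omega>)) * \<phi> (B a \<omega>) \<partial>N) =
        (\<integral>\<^sup>+\<omega>. H (B a \<omega>) * \<phi> (B a \<omega>) \<partial>N)"
    and HY: "\<And>V. finite V \<Longrightarrow> V \<subseteq> {a<..} \<Longrightarrow>
        (\<integral>\<^sup>+\<omega>. (\<Prod>u\<in>U \<union> V. f u (time_inversion c W u \<omega>)) \<partial>M) =
        (\<integral>\<^sup>+\<omega>. (\<Prod>u\<in>V. f u (time_inversion c W u \<omega>)) * H (time_inversion c W a \<omega>) \<partial>M)"
    using time_inversion_common_kernel[OF M W N B c _ U(1) False U(2), of f] f unfolding a_def by auto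
  have "(\<integral>\<^sup>+\<omega>. (\<Prod>u\<in>U. f u (B u \<omega>)) \<partial>N) = (\<integral>\<^sup>+\<omega>. H (B a \<omega>) \<partial>N)"
    using HB[of "\<lambda>_. 1"] by simp
  also have "\<dots> = (\<integral>\<^sup>+\<omega>. H (time_inversion c W a \<omega>) \<partial>M)"
    using wiener_marginal[OF N B a0 a(2) H] time_inversion_marginal[OF M W c a(1) H] by simp
  also have "\<dots> = (\<integral>\<^sup>+\<omega>. (\<Prod>u\<in>U. f u (time_inversion c W u \<omega>)) \<partial>M)"
    using HY[of "{}"] by simp
  finally show ?thesis by simp
qed

section \<open>Bands of continuous paths as countable events\<close>

lemma continuous_nonpos_iff_rational:
  fixes h :: "real \<Rightarrow> real"
  assumes "\<alpha> < \<beta>" "continuous_on {\<alpha>..\<beta>} h"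
  shows "(\<forall>x\<in>{\<alpha>..\<beta>}. h x \<le> 0) \<longleftrightarrow> (\<forall>x\<in>{\<alpha><..<\<beta>} \<inter> \<rat>. h x \<le> 0)"
proof safe
  have cl: "closure ({\<alpha><..<\<beta>} \<inter> \<rat>) = {\<alpha>..\<beta>}"
    using assms(1) by (subst closure_open_Int_superset) (auto simp: Rats_closure_real)
  fix x assume *: "\<forall>x\<in>{\<alpha><..<\<beta>} \<inter> \<rat>. h x \<le> 0" and "x \<in> {\<alpha>..\<beta>}"
  then show "h x \<le> 0"
    using continuous_le_on_closure[of "{\<alpha><..<\<beta>} \<inter> \<rat>" h x 0] assms(2) cl by auto
qed auto

lemma countable_band_sets:
  assumes "countable D" "\<And>u. u \<in> D \<Longrightarrow> X u \<in> borel_measurable M"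
    and "\<And>u. u \<in> D \<Longrightarrow> A u \<in> sets borel"
  shows "{\<omega> \<in> space M. \<forall>u\<in>D. X u \<omega> \<in> A u} \<in> sets M"
proof -
  have "{\<omega> \<in> space M. X u \<omega> \<in> A u} \<in> sets M" if "u \<in> D" for u
    using measurable_sets[OF assms(2,3)[OF that]] by (simp add: vimage_def Int_def conj_commute)
  then show ?thesis using assms(1) by (intro sets.sets_Collect_countable_All')
qed

text \<open>Finite intersections have equal probabilities, since products of indicators are their
  indicator functions; exhausting \<open>D\<close> by finite sets and continuity from above give the
  countable intersection.\<close>

lemma measure_eq_countable:
  fixes X :: "'i \<Rightarrow> 'a \<Rightarrow> real" and Z :: "'i \<Rightarrow> 'b \<Rightarrow> real"
  assumes M: "prob_space M" and N: "prob_space N" and D: "countable D"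
    and X: "\<And>u. u \<in> D \<Longrightarrow> X u \<in> borel_measurable M"
    and Z: "\<And>u. u \<in> D \<Longrightarrow> Z u \<in> borel_measurable N"
    and A: "\<And>u. u \<in> D \<Longrightarrow> A u \<in> sets borel"
    and eq: "\<And>U. finite U \<Longrightarrow> U \<subseteq> D \<Longrightarrow>
       (\<integral>\<^sup>+\<omega>. (\<Prod>u\<in>U. indicator (A u) (X u \<omega>)) \<partial>M) = (\<integral>\<^sup>+\<omega>. (\<Prod>u\<in>U. indicator (A u) (Z u \<omega>)) \<partial>N)"
  shows "measure M {\<omega> \<in> space M. \<forall>u\<in>D. X u \<omega> \<in> A u} = measure N {\<omega> \<in> space N. \<forall>u\<in>D. Z u \<omega> \<in> A u}"
proof -
  interpret M: prob_space M by fact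
  interpret N: prob_space N by fact
  have ind: "(\<Prod>u\<in>U. indicator (A u) (Y u \<omega>)) = (indicator {\<omega> \<in> S. \<forall>u\<in>U. Y u \<omega> \<in> A u} \<omega> :: ennreal)"
    if "finite U" "\<omega> \<in> S" for U and Y :: "'i \<Rightarrow> 'c \<Rightarrow> real" and \<omega> S
    using that(1) by (induction U rule: finite_induct) (use that(2) in \<open>auto simp: indicator_def\<close>)
  have fin: "measure M {\<omega> \<in> space M. \<forall>u\<in>U. X u \<omega> \<in> A u} = measure N {\<omega> \<in> space N. \<forall>u\<in>U. Z u \<omega> \<in> A u}"
    if U: "finite U" "U \<subseteq> D" for U
  proof -
    have "emeasure M {\<omega> \<in> space M. \<forall>u\<in>U. X u \<omega> \<in> A u} = (\<integral>\<^sup>+\<omega>. (\<Prod>u\<in>U. indicator (A u) (X u \<omega>)) \<partial>M)"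
      using U X A
      by (subst nn_integral_cong[OF ind])
        (auto intro!: countable_band_sets nn_integral_indicator[symmetric] nn_integral_indicator simp: countable_finite)
    also have "\<dots> = (\<integral>\<^sup>+\<omega>. (\<Prod>u\<in>U. indicator (A u) (Z u \<omega>)) \<partial>N)" by (rule eq[OF U])
    also have "\<dots> = emeasure N {\<omega> \<in> space N. \<forall>u\<in>U. Z u \<omega> \<in> A u}"
      using U Z A
      by (subst nn_integral_cong[OF ind])
        (auto intro!: countable_band_sets nn_integral_indicator[symmetric] nn_integral_indicator simp: countable_finite)
    finally show ?thesis by (simp add: measure_def)
  qed
  \<comment> \<open>The members of \<open>D\<close> whose number in a fixed enumeration is below
    \<open>m\<close>: finite sets increasing to \<open>D\<close>.\<close>
  define E where "E m = {u \<in> D. to_nat_on D u < m}" for m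
  have E: "finite (E m)" "E m \<subseteq> D" for m
  proof -
    have "inj_on (to_nat_on D) (E m)" using D inj_on_to_nat_on[of D] by (auto simp: E_def intro: inj_on_subset)
    then show "finite (E m)" by (rule finite_imageD[rotated]) (auto intro!: finite_subset[of _ "{..<m}"] simp: E_def)
  qed (auto simp: E_def)
  have Ex: "\<exists>m. u \<in> E m" if "u \<in> D" for u using that by (auto simp: E_def)
  have "(\<lambda>m. measure M {\<omega> \<in> space M. \<forall>u\<in>E m. X u \<omega> \<in> A u}) \<longlonglongrightarrow> measure M (\<Inter>m. {\<omega> \<in> space M. \<forall>u\<in>E m. X u \<omega> \<in> A u})"
    using countable_band_sets[OF countable_subset[OF E(2) D], where X=X and M=M and A=A] X A E(2)
    by (intro M.finite_Lim_measure_decseq image_subsetI) (auto simp: decseq_def E_def)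
  moreover have "(\<Inter>m. {\<omega> \<in> space M. \<forall>u\<in>E m. X u \<omega> \<in> A u}) = {\<omega> \<in> space M. \<forall>u\<in>D. X u \<omega> \<in> A u}"
    using Ex E(2) by fastforce
  moreover have "(\<lambda>m. measure N {\<omega> \<in> space N. \<forall>u\<in>E m. Z u \<omega> \<in> A u}) \<longlonglongrightarrow> measure N (\<Inter>m. {\<omega> \<in> space N. \<forall>u\<in>E m. Z u \<omega> \<in> A u})"
    using countable_band_sets[OF countable_subset[OF E(2) D], where X=Z and M=N and A=A] Z A E(2)
    by (intro N.finite_Lim_measure_decseq image_subsetI) (auto simp: decseq_def E_def)
  moreover have "(\<Inter>m. {\<omega> \<in> space N. \<forall>u\<in>E m. Z u \<omega> \<in> A u}) = {\<omega> \<in> space N. \<forall>u\<in>D. Z u \<omega> \<in> A u}"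
    using Ex E(2) by fastforce
  ultimately show ?thesis using fin[OF E] LIMSEQ_unique by auto
qed

lemma band_iff_rational:
  fixes w h :: "real \<Rightarrow> real"
  assumes "\<alpha> < \<beta>" "continuous_on {\<alpha>..\<beta>} w" "continuous_on {\<alpha>..\<beta>} h"
  shows "(\<forall>x\<in>{\<alpha>..\<beta>}. \<bar>w x\<bar> \<le> h x) \<longleftrightarrow> (\<forall>x\<in>{\<alpha><..<\<beta>} \<inter> \<rat>. w x \<in> {- h x..h x})"
proof -
  have 1: "w x \<in> {- h x..h x} \<longleftrightarrow> \<bar>w x\<bar> - h x \<le> 0" for x by auto
  have 2: "\<bar>w x\<bar> \<le> h x \<longleftrightarrow> \<bar>w x\<bar> - h x \<le> 0" for x by auto
  show ?thesis unfolding 1 unfolding 2 using assms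
    by (intro continuous_nonpos_iff_rational continuous_intros)
qed

lemma countable_rational_interval: "countable ({\<alpha><..<\<beta>} \<inter> \<rat> :: real set)"
  using countable_rat by (rule countable_subset[rotated]) auto

lemma wiener_band_rational:
  assumes W: "wiener_on M L W" and \<alpha>\<beta>: "0 \<le> \<alpha>" "\<alpha> < \<beta>" "\<beta> \<le> L" and h: "continuous_on {\<alpha>..\<beta>} h"
  shows "{\<omega> \<in> space M. \<forall>x\<in>{\<alpha>..\<beta>}. \<bar>W x \<omega>\<bar> \<le> h x} =
    {\<omega> \<in> space M. \<forall>x\<in>{\<alpha><..<\<beta>} \<inter> \<rat>. W x \<omega> \<in> {- h x..h x}}"
proof (rule Collect_cong, rule conj_cong[OF refl])
  fix \<omega> assume "\<omega> \<in> space M"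
  then have "continuous_on {\<alpha>..\<beta>} (\<lambda>x. W x \<omega>)"
    using \<alpha>\<beta> by (intro continuous_on_subset[OF wiener_on_continuous[OF W]]) auto
  from band_iff_rational[OF \<alpha>\<beta>(2) this h]
  show "(\<forall>x\<in>{\<alpha>..\<beta>}. \<bar>W x \<omega>\<bar> \<le> h x) \<longleftrightarrow> (\<forall>x\<in>{\<alpha><..<\<beta>} \<inter> \<rat>. W x \<omega> \<in> {- h x..h x})" .
qed

lemma wiener_band_sets:
  assumes W: "wiener_on M L W" and \<alpha>\<beta>: "0 \<le> \<alpha>" "\<alpha> < \<beta>" "\<beta> \<le> L" and h: "continuous_on {\<alpha>..\<beta>} h"
  shows "{\<omega> \<in> space M. \<forall>x\<in>{\<alpha>..\<beta>}. \<bar>W x \<omega>\<bar> \<le> h x} \<in> sets M"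
  unfolding wiener_band_rational[OF assms] using \<alpha>\<beta>
  by (intro countable_band_sets countable_rational_interval wiener_on_measurable[OF W]) auto

text \<open>For a constant barrier on [0, 1] this is the event that the larger of the two suprema is
  at most that constant. The barrier is a function because inversion bends a constant one into a
  line, and because a linear one controls growth.\<close>

definition pair_band :: "'a measure \<Rightarrow> (real \<Rightarrow> 'a \<Rightarrow> real) \<Rightarrow> (real \<Rightarrow> 'a \<Rightarrow> real) \<Rightarrow> real set \<Rightarrow> (real \<Rightarrow> real) \<Rightarrow> 'a set" where
  "pair_band M W1 W2 I h =
    {\<omega> \<in> space M. (\<forall>x\<in>I. \<bar>W1 x \<omega>\<bar> \<le> h x) \<and> (\<forall>x\<in>I. \<bar>W2 x \<omega>\<bar> \<le> h x)}"

lemma pair_band_Int: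
  "pair_band M W1 W2 I h = {\<omega> \<in> space M. \<forall>x\<in>I. \<bar>W1 x \<omega>\<bar> \<le> h x} \<inter> {\<omega> \<in> space M. \<forall>x\<in>I. \<bar>W2 x \<omega>\<bar> \<le> h x}"
  by (auto simp: pair_band_def)

lemma pair_band_sets:
  assumes "wiener_on M L W1" "wiener_on M L W2" "0 \<le> \<alpha>" "\<alpha> < \<beta>" "\<beta> \<le> L" "continuous_on {\<alpha>..\<beta>} h"
  shows "pair_band M W1 W2 {\<alpha>..\<beta>} h \<in> sets M"
  unfolding pair_band_Int using assms by (intro sets.Int wiener_band_sets)

lemma indep_processes_band:
  assumes M: "prob_space M" and W: "wiener_on M L W1" "wiener_on M L W2" "indep_processes M L W1 W2"
    and \<alpha>\<beta>: "0 \<le> \<alpha>" "\<alpha> < \<beta>" "\<beta> \<le> L" and h: "continuous_on {\<alpha>..\<beta>} h"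
  shows "measure M (pair_band M W1 W2 {\<alpha>..\<beta>} h) =
     measure M {\<omega> \<in> space M. \<forall>x\<in>{\<alpha>..\<beta>}. \<bar>W1 x \<omega>\<bar> \<le> h x} *
     measure M {\<omega> \<in> space M. \<forall>x\<in>{\<alpha>..\<beta>}. \<bar>W2 x \<omega>\<bar> \<le> h x}"
proof -
  interpret prob_space M by fact
  let ?P = "Pi\<^sub>M {0..L} (\<lambda>_. borel :: real measure)"
  let ?D = "{\<alpha><..<\<beta>} \<inter> \<rat>"
  \<comment> \<open>Independence speaks of the product sigma-algebra on paths, where a band over
    uncountably many times is in general not measurable. The band over rational times is measurable
    and has the same preimage because the paths are continuous.\<close>
  define E where "E = {p \<in> space ?P. \<forall>x\<in>?D. p x \<in> {- h x..h x}}"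
  have E: "E \<in> sets ?P" unfolding E_def using \<alpha>\<beta>
    by (intro countable_band_sets countable_rational_interval measurable_component_singleton) auto
  have pre: "(\<lambda>\<omega>. \<lambda>t\<in>{0..L}. W t \<omega>) -` E \<inter> space M = {\<omega> \<in> space M. \<forall>x\<in>{\<alpha>..\<beta>}. \<bar>W x \<omega>\<bar> \<le> h x}"
    if "wiener_on M L W" for W
    unfolding wiener_band_rational[OF that \<alpha>\<beta> h] using \<alpha>\<beta> by (auto simp: E_def space_PiM)
  have "prob ((\<lambda>x. (\<lambda>t\<in>{0..L}. W1 t x, \<lambda>t\<in>{0..L}. W2 t x)) -` (E \<times> E) \<inter> space M) =
    prob ((\<lambda>\<omega>. \<lambda>t\<in>{0..L}. W1 t \<omega>) -` E \<inter> space M) * prob ((\<lambda>\<omega>. \<lambda>t\<in>{0..L}. W2 t \<omega>) -` E \<inter> space M)"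
    using W(3) unfolding indep_processes_def by (rule indep_varD) (rule E)+
  moreover have "(\<lambda>x. (\<lambda>t\<in>{0..L}. W1 t x, \<lambda>t\<in>{0..L}. W2 t x)) -` (E \<times> E) \<inter> space M =
     ((\<lambda>\<omega>. \<lambda>t\<in>{0..L}. W1 t \<omega>) -` E \<inter> space M) \<inter> ((\<lambda>\<omega>. \<lambda>t\<in>{0..L}. W2 t \<omega>) -` E \<inter> space M)"
    by auto
  ultimately show ?thesis by (simp only: pre[OF W(1)] pre[OF W(2)] pair_band_Int)
qed

text \<open>Substituting u = c/x turns the first band into |Y u| \<le> g u for the inverted process
  \<open>Y\<close>, path by path. Over rational u the two events then have equal probability by
  equality of the finite-dimensional laws.\<close>

lemma time_inversion_band:
  assumes M: "prob_space M" and W: "wiener_on M L W"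
    and N: "prob_space N" and B: "wiener_on N 1 B"
    and c: "0 < c" "c < L" and g: "continuous_on {c / L..1} g"
  shows "measure M {\<omega> \<in> space M. \<forall>x\<in>{c..L}. \<bar>W x \<omega>\<bar> \<le> x / sqrt c * g (c / x)} =
    measure N {\<omega> \<in> space N. \<forall>u\<in>{c / L..1}. \<bar>B u \<omega>\<bar> \<le> g u}"
proof -
  let ?Y = "time_inversion c W"
  let ?D = "{c / L<..<1} \<inter> \<rat>"
  have L: "0 < L" and cL: "0 < c / L" "c / L < 1" using c by auto
  have Yi: "\<bar>W x \<omega>\<bar> \<le> x / sqrt c * g (c / x) \<longleftrightarrow> \<bar>?Y (c / x) \<omega>\<bar> \<le> g (c / x)" if "0 < x" for x \<omega>
  proof -
    have "?Y (c / x) \<omega> = W x \<omega> / (x / sqrt c)"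
      using c that by (simp add: time_inversion_def field_simps real_div_sqrt)
    moreover have k: "0 < x / sqrt c" using c that by simp
    ultimately show ?thesis
      by (simp only: abs_div_pos[OF k, symmetric] pos_divide_le_eq[OF k] mult.commute[of "g (c / x)"])
  qed
  have "(\<forall>x\<in>{c..L}. \<bar>W x \<omega>\<bar> \<le> x / sqrt c * g (c / x)) \<longleftrightarrow> (\<forall>u\<in>{c / L..1}. \<bar>?Y u \<omega>\<bar> \<le> g u)" for \<omega>
  proof safe
    fix u assume *: "\<forall>x\<in>{c..L}. \<bar>W x \<omega>\<bar> \<le> x / sqrt c * g (c / x)" and u: "u \<in> {c / L..1}"
    then have u0: "0 < u" using cL by auto
    have "c / u \<in> {c..L}" using u u0 c L by (auto simp: field_simps)
    with * have "\<bar>W (c / u) \<omega>\<bar> \<le> c / u / sqrt c * g (c / (c / u))" by blast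
    then have "\<bar>?Y (c / (c / u)) \<omega>\<bar> \<le> g (c / (c / u))"
      using Yi[of "c / u" \<omega>] u0 c by (simp only: divide_pos_pos)
    then show "\<bar>?Y u \<omega>\<bar> \<le> g u" using u0 c by simp
  next
    fix x assume *: "\<forall>u\<in>{c / L..1}. \<bar>?Y u \<omega>\<bar> \<le> g u" and x: "x \<in> {c..L}"
    then have "c / x \<in> {c / L..1}" using c by (auto simp: field_simps)
    with * have "\<bar>?Y (c / x) \<omega>\<bar> \<le> g (c / x)" by blast
    then show "\<bar>W x \<omega>\<bar> \<le> x / sqrt c * g (c / x)" using x c by (subst Yi) auto
  qed
  moreover have "(\<forall>u\<in>{c / L..1}. \<bar>?Y u \<omega>\<bar> \<le> g u) \<longleftrightarrow> (\<forall>u\<in>?D. ?Y u \<omega> \<in> {- g u..g u})" if "\<omega> \<in> space M" for \<omega>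
  proof (rule band_iff_rational[OF cL(2) _ g])
    have "continuous_on {c / L..1} (\<lambda>u. W (c / u) \<omega>)"
    proof (rule continuous_on_compose2[OF wiener_on_continuous[OF W that]])
      show "continuous_on {c / L..1} ((/) c)" using cL by (intro continuous_intros) auto
      show "(/) c ` {c / L..1} \<subseteq> {0..L}"
      proof safe
        fix u assume "u \<in> {c / L..1}"
        moreover then have "0 < u" using cL by auto
        ultimately show "c / u \<in> {0..L}" using c L by (auto simp: field_simps)
      qed
    qed
    then show "continuous_on {c / L..1} (\<lambda>u. ?Y u \<omega>)"
      unfolding time_inversion_def using c by (intro continuous_intros) auto
  qed
  ultimately have "{\<omega> \<in> space M. \<forall>x\<in>{c..L}. \<bar>W x \<omega>\<bar> \<le> x / sqrt c * g (c / x)} =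
     {\<omega> \<in> space M. \<forall>u\<in>?D. ?Y u \<omega> \<in> {- g u..g u}}" by auto
  also have "measure M \<dots> = measure N {\<omega> \<in> space N. \<forall>u\<in>?D. B u \<omega> \<in> {- g u..g u}}"
  proof (rule measure_eq_countable[OF M N countable_rational_interval])
    fix u assume "u \<in> ?D"
    then have u: "c / L < u" "u < 1" by auto
    then have "0 < u" using cL by simp
    then have "c / u \<in> {0..L}" using u c L by (auto simp: field_simps)
    then have "W (c / u) \<in> borel_measurable M" by (rule wiener_on_measurable[OF W])
    then show "?Y u \<in> borel_measurable M" unfolding time_inversion_def[abs_def] by measurable
    show "B u \<in> borel_measurable N" using u \<open>0 < u\<close> by (intro wiener_on_measurable[OF B]) auto
  next
    fix U assume "finite U" "U \<subseteq> ?D"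
    then show "(\<integral>\<^sup>+\<omega>. (\<Prod>u\<in>U. indicator {- g u..g u} (?Y u \<omega>)) \<partial>M) =
        (\<integral>\<^sup>+\<omega>. (\<Prod>u\<in>U. indicator {- g u..g u} (B u \<omega>)) \<partial>N)"
      using c by (intro time_inversion_same_law[OF M W N B]) auto
  qed auto
  also have "{\<omega> \<in> space N. \<forall>u\<in>?D. B u \<omega> \<in> {- g u..g u}} = {\<omega> \<in> space N. \<forall>u\<in>{c / L..1}. \<bar>B u \<omega>\<bar> \<le> g u}"
    using cL by (intro wiener_band_rational[OF B _ _ _ g, symmetric]) auto
  finally show ?thesis .
qed

text \<open>Independence factors both probabilities, and the factors agree one by one, so no joint
  law of the two inverted processes has to be computed.\<close>

lemma time_inversion_band2:
  assumes M: "prob_space M" and W: "wiener_on M L W1" "wiener_on M L W2" "indep_processes M L W1 W2"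
    and N: "prob_space N" and B: "wiener_on N 1 B1" "wiener_on N 1 B2" "indep_processes N 1 B1 B2"
    and c: "0 < c" "c < L" and g: "continuous_on {c / L..1} g"
  shows "measure M (pair_band M W1 W2 {c..L} (\<lambda>x. x / sqrt c * g (c / x))) =
    measure N (pair_band N B1 B2 {c / L..1} g)"
proof -
  have L: "0 < L" and cL: "0 < c / L" "c / L < 1" using c by auto
  have "continuous_on {c..L} (\<lambda>x. g (c / x))"
  proof (rule continuous_on_compose2[OF g])
    show "continuous_on {c..L} ((/) c)" using c by (intro continuous_intros) auto
    show "(/) c ` {c..L} \<subseteq> {c / L..1}" using c by (auto simp: field_simps)
  qed
  then have h: "continuous_on {c..L} (\<lambda>x. x / sqrt c * g (c / x))"
    using c by (intro continuous_intros) auto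
  show ?thesis
    using c cL by (subst indep_processes_band[OF M W _ _ _ h], simp, simp, simp,
      subst indep_processes_band[OF N B _ _ _ g], simp, simp, simp)
      (simp only: time_inversion_band[OF M W(1) N B(1) c g] time_inversion_band[OF M W(2) N B(2) c g])
qed

section \<open>The sandwich along a single path\<close>

text \<open>The normalized approximation error is largest at the left end \<open>n\<close>, because
  x^(\<kappa>-1) decreases. The bound tends to 0 with growing \<open>n\<close> exactly when \<kappa>
  < 1/2.\<close>

lemma scaled_powr_bound:
  fixes n x \<kappa> :: real
  assumes "0 < n" "n \<le> x" "\<kappa> < 1"
  shows "sqrt n * x powr \<kappa> / x \<le> n powr (\<kappa> - 1/2)"
proof -
  have "x powr \<kappa> / x = x powr (\<kappa> - 1)"
    using assms by (simp add: powr_diff)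
  also have "\<dots> \<le> n powr (\<kappa> - 1)" using assms by (intro powr_mono2') auto
  finally have "sqrt n * (x powr \<kappa> / x) \<le> sqrt n * n powr (\<kappa> - 1)"
    using assms by (intro mult_left_mono) auto
  also have "\<dots> = n powr (1/2) * n powr (\<kappa> - 1)"
    using assms by (simp add: powr_half_sqrt)
  also have "\<dots> = n powr (\<kappa> - 1/2)" by (simp add: powr_add[symmetric])
  finally show ?thesis by simp
qed

text \<open>The deterministic situation at one outcome and one T. Besides the approximation bounds
  it assumes \<open>small1\<close> and \<open>small2\<close>: they make the total sum, multiplied by
  sqrt n, small compared with T, so that an average over a positive fraction of the sample is
  negligible.\<close>

locale approximated_path =
  fixes e :: "nat \<Rightarrow> real" and w1 w2 :: "real \<Rightarrow> real" and n T :: nat and C \<sigma> \<kappa> \<epsilon> :: real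
  assumes n: "1 \<le> n" "2 * n < T" and \<sigma>: "0 < \<sigma>" and C: "0 \<le> C" and \<kappa>: "\<kappa> < 1/2"
    and approx1: "\<And>x. 1 \<le> x \<Longrightarrow> x \<le> real T / 2 \<Longrightarrow>
      \<bar>(\<Sum>s=1..nat \<lfloor>x\<rfloor>. e s) - \<sigma> * w1 x\<bar> \<le> C * x powr \<kappa>"
    and approx2: "\<And>x. real T / 2 \<le> x \<Longrightarrow> x \<le> real T - 1 \<Longrightarrow>
      \<bar>(\<Sum>s=nat \<lfloor>x\<rfloor>+1..T. e s) - \<sigma> * w2 (real T - x)\<bar> \<le> C * (real T - x) powr \<kappa>"
    and small1: "\<And>x. real n \<le> x \<Longrightarrow> x \<le> real T / 2 \<Longrightarrow> sqrt (real n) * \<bar>w1 x\<bar> \<le> \<epsilon> * real T"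
    and small2: "\<And>x. real n \<le> x \<Longrightarrow> x \<le> real T / 2 \<Longrightarrow> sqrt (real n) * \<bar>w2 x\<bar> \<le> \<epsilon> * real T"
begin

definition "S k = (\<Sum>s=1..k. e s)"
definition "R k = (\<Sum>s=k+1..T. e s)"
definition "\<rho> = C / \<sigma> * real n powr (\<kappa> - 1/2)"
text \<open>The far average costs 9 (\<epsilon> + \<rho>/2) by \<open>far_mean_small\<close>, and
  replacing the near partial sum by the Wiener path costs one more \<rho>. The resulting 5.5 \<rho>
  is rounded up to 6 \<rho>.\<close>

definition "\<eta> = 9 * \<epsilon> + 6 * \<rho>"
definition "d t = \<bar>(1 / real t) * S t - (1 / (real T - real t)) * R t\<bar>"

lemma S_plus_R: "k \<le> T \<Longrightarrow> S k + R k = S T"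
  unfolding S_def R_def using sum.ub_add_nat[of 1 k e "T - k"] by simp

lemma \<rho>_nonneg: "0 \<le> \<rho>" using C \<sigma> by (simp add: \<rho>_def)

lemma \<epsilon>_nonneg: "0 \<le> \<epsilon>"
proof -
  have "0 \<le> sqrt (real n) * \<bar>w1 (real n)\<bar>" by simp
  also have "\<dots> \<le> \<epsilon> * real T" using n by (intro small1) auto
  finally show ?thesis using n by (simp add: zero_le_mult_iff)
qed

text \<open>The denominator is the real point x even though the sum stops at an integer. The passage
  to the integer denominator is postponed to \<open>statistic_imp_wiener_band\<close>, the only
  place where it costs anything.\<close>

lemma rescale_error:
  assumes "\<bar>s - \<sigma> * w\<bar> \<le> C * x powr \<kappa>" "real n \<le> x"
  shows "\<bar>sqrt (real n) * \<bar>s\<bar> / (\<sigma> * x) - sqrt (real n) * \<bar>w\<bar> / x\<bar> \<le> \<rho>"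
proof -
  have x: "0 < x" "0 < real n" using assms(2) n by auto
  have "\<bar>\<bar>s\<bar> - \<sigma> * \<bar>w\<bar>\<bar> \<le> C * x powr \<kappa>"
  proof -
    have "\<sigma> * \<bar>w\<bar> = \<bar>\<sigma> * w\<bar>" using \<sigma> by (simp add: abs_mult)
    then show ?thesis using assms(1) by linarith
  qed
  then have "sqrt (real n) / (\<sigma> * x) * \<bar>\<bar>s\<bar> - \<sigma> * \<bar>w\<bar>\<bar> \<le> sqrt (real n) / (\<sigma> * x) * (C * x powr \<kappa>)"
    using x \<sigma> by (intro mult_left_mono) auto
  also have "\<dots> = C / \<sigma> * (sqrt (real n) * x powr \<kappa> / x)" by (simp add: field_simps)
  also have "\<dots> \<le> \<rho>" unfolding \<rho>_def
    using C \<sigma> x assms \<kappa> by (intro mult_left_mono scaled_powr_bound) auto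
  also have "sqrt (real n) / (\<sigma> * x) * \<bar>\<bar>s\<bar> - \<sigma> * \<bar>w\<bar>\<bar> =
      \<bar>sqrt (real n) / (\<sigma> * x) * (\<bar>s\<bar> - \<sigma> * \<bar>w\<bar>)\<bar>"
    using x \<sigma> by (simp add: abs_mult)
  also have "sqrt (real n) / (\<sigma> * x) * (\<bar>s\<bar> - \<sigma> * \<bar>w\<bar>) =
      sqrt (real n) * \<bar>s\<bar> / (\<sigma> * x) - sqrt (real n) * \<bar>w\<bar> / x"
    using x \<sigma> by (simp add: field_simps)
  finally show ?thesis .
qed

lemma S_error:
  assumes "real n \<le> x" "x \<le> real T / 2"
  shows "\<bar>sqrt (real n) * \<bar>S (nat \<lfloor>x\<rfloor>)\<bar> / (\<sigma> * x) - sqrt (real n) * \<bar>w1 x\<bar> / x\<bar> \<le> \<rho>"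
  unfolding S_def using assms n by (intro rescale_error approx1) auto

lemma R_error:
  assumes "real n \<le> y" "y \<le> real T / 2"
  shows "\<bar>sqrt (real n) * \<bar>R (nat \<lfloor>real T - y\<rfloor>)\<bar> / (\<sigma> * y) - sqrt (real n) * \<bar>w2 y\<bar> / y\<bar> \<le> \<rho>"
  unfolding R_def using assms n approx2[of "real T - y"] by (intro rescale_error) auto

lemma partial_sum_size:
  assumes "\<bar>sqrt (real n) * \<bar>s\<bar> / (\<sigma> * x) - sqrt (real n) * \<bar>w\<bar> / x\<bar> \<le> \<rho>"
    "sqrt (real n) * \<bar>w\<bar> \<le> \<epsilon> * real T" "real n \<le> x" "x \<le> real T / 2"
  shows "sqrt (real n) * \<bar>s\<bar> \<le> \<sigma> * (real T * (\<epsilon> + \<rho> / 2))"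
proof -
  have x: "0 < x" using assms n by auto
  have "sqrt (real n) * \<bar>s\<bar> / (\<sigma> * x) \<le> sqrt (real n) * \<bar>w\<bar> / x + \<rho>" using assms(1) by linarith
  then have "sqrt (real n) * \<bar>s\<bar> \<le> (sqrt (real n) * \<bar>w\<bar> / x + \<rho>) * (\<sigma> * x)"
    using x \<sigma> by (subst (asm) pos_divide_le_eq) auto
  also have "\<dots> = \<sigma> * (sqrt (real n) * \<bar>w\<bar> + x * \<rho>)" using x by (simp add: field_simps)
  also have "\<dots> \<le> \<sigma> * (\<epsilon> * real T + real T / 2 * \<rho>)"
    using assms \<rho>_nonneg \<sigma> by (intro mult_left_mono add_mono mult_right_mono) auto
  finally show ?thesis by (simp add: algebra_simps)
qed

lemma S_size:
  assumes "real n \<le> x" "x \<le> real T / 2"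
  shows "sqrt (real n) * \<bar>S (nat \<lfloor>x\<rfloor>)\<bar> \<le> \<sigma> * (real T * (\<epsilon> + \<rho> / 2))"
  by (rule partial_sum_size[OF S_error small1]) (use assms in auto)

lemma R_size:
  assumes "real n \<le> x" "x \<le> real T / 2"
  shows "sqrt (real n) * \<bar>R (nat \<lfloor>real T - x\<rfloor>)\<bar> \<le> \<sigma> * (real T * (\<epsilon> + \<rho> / 2))"
  by (rule partial_sum_size[OF R_error small2]) (use assms in auto)

text \<open>Each approximation covers only half of the sample, so the total is cut at T/2, where
  both are valid.\<close>

lemma total_size: "sqrt (real n) * \<bar>S T\<bar> \<le> 2 * (\<sigma> * (real T * (\<epsilon> + \<rho> / 2)))"
proof -
  let ?h = "nat \<lfloor>real T / 2\<rfloor>"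
  have h: "real T - real T / 2 = real T / 2" by simp
  have "?h \<le> T" by linarith
  then have "\<bar>S T\<bar> \<le> \<bar>S ?h\<bar> + \<bar>R ?h\<bar>" using S_plus_R[of ?h] by linarith
  then have "sqrt (real n) * \<bar>S T\<bar> \<le> sqrt (real n) * \<bar>S ?h\<bar> + sqrt (real n) * \<bar>R ?h\<bar>"
    by (simp add: distrib_left[symmetric] mult_left_mono)
  also have "\<dots> \<le> \<sigma> * (real T * (\<epsilon> + \<rho> / 2)) + \<sigma> * (real T * (\<epsilon> + \<rho> / 2))"
    using n by (intro add_mono S_size R_size[of "real T / 2", unfolded h]) auto
  finally show ?thesis by simp
qed

text \<open>The far sum is the total minus the near sum, hence at most three units of
  \<sigma>T(\<epsilon> + \<rho>/2); division by at least \<sigma>T/3 produces the factor 9.\<close>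

lemma far_mean_small:
  assumes "sqrt (real n) * \<bar>s\<bar> \<le> \<sigma> * (real T * (\<epsilon> + \<rho> / 2))" "s + r = S T" "real T / 3 \<le> m"
  shows "sqrt (real n) * \<bar>r\<bar> / (\<sigma> * m) \<le> \<eta> - \<rho>"
proof -
  have "\<bar>r\<bar> \<le> \<bar>S T\<bar> + \<bar>s\<bar>" using assms(2) by linarith
  then have "sqrt (real n) * \<bar>r\<bar> \<le> sqrt (real n) * \<bar>S T\<bar> + sqrt (real n) * \<bar>s\<bar>"
    by (simp add: distrib_left[symmetric] mult_left_mono)
  also have "\<dots> \<le> 3 * (\<sigma> * (real T * (\<epsilon> + \<rho> / 2)))" using add_mono[OF total_size assms(1)] by simp
  also have "\<dots> = 9 * (\<epsilon> + \<rho> / 2) * (\<sigma> * (real T / 3))" by simp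
  also have "\<dots> \<le> 9 * (\<epsilon> + \<rho> / 2) * (\<sigma> * m)"
    using assms(3) \<sigma> \<epsilon>_nonneg \<rho>_nonneg by (intro mult_left_mono) auto
  finally have "sqrt (real n) * \<bar>r\<bar> \<le> 9 * (\<epsilon> + \<rho> / 2) * (\<sigma> * m)" .
  moreover have "0 < \<sigma> * m" using assms(3) \<sigma> n by auto
  ultimately have "sqrt (real n) * \<bar>r\<bar> / (\<sigma> * m) \<le> 9 * (\<epsilon> + \<rho> / 2)"
    by (simp add: pos_divide_le_eq)
  then show ?thesis using \<rho>_nonneg by (simp add: \<eta>_def)
qed

definition "P t = sqrt (real n) * \<bar>S t\<bar> / (\<sigma> * real t)"
definition "Q t = sqrt (real n) * \<bar>R t\<bar> / (\<sigma> * (real T - real t))"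

lemma d_bounds:
  assumes "t \<le> T"
  shows "sqrt (real n) * d t / \<sigma> \<le> P t + Q t" "\<bar>P t - Q t\<bar> \<le> sqrt (real n) * d t / \<sigma>"
proof -
  let ?p = "(1 / real t) * S t" and ?q = "(1 / (real T - real t)) * R t"
  have P: "P t = sqrt (real n) / \<sigma> * \<bar>?p\<bar>" by (simp add: P_def abs_mult)
  have Q: "Q t = sqrt (real n) / \<sigma> * \<bar>?q\<bar>" using assms by (simp add: Q_def abs_mult)
  have k: "0 \<le> sqrt (real n) / \<sigma>" using \<sigma> by simp
  have "sqrt (real n) / \<sigma> * d t \<le> sqrt (real n) / \<sigma> * (\<bar>?p\<bar> + \<bar>?q\<bar>)"
    unfolding d_def by (intro mult_left_mono k) linarith
  then show "sqrt (real n) * d t / \<sigma> \<le> P t + Q t" unfolding P Q by (simp add: algebra_simps)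
  have "sqrt (real n) / \<sigma> * \<bar>\<bar>?p\<bar> - \<bar>?q\<bar>\<bar> \<le> sqrt (real n) / \<sigma> * d t"
    unfolding d_def by (intro mult_left_mono k) linarith
  moreover have "\<bar>P t - Q t\<bar> = sqrt (real n) / \<sigma> * \<bar>\<bar>?p\<bar> - \<bar>?q\<bar>\<bar>"
    unfolding P Q right_diff_distrib[symmetric] abs_mult[of "sqrt (real n) / \<sigma>"] using \<sigma> by simp
  ultimately show "\<bar>P t - Q t\<bar> \<le> sqrt (real n) * d t / \<sigma>" by simp
qed

lemma Q_small:
  assumes "real n \<le> x" "x \<le> real T / 2"
  shows "Q (nat \<lfloor>x\<rfloor>) \<le> \<eta> - \<rho>"
proof -
  have "real (nat \<lfloor>x\<rfloor>) \<le> real T / 2" using assms n by linarith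
  then show ?thesis unfolding Q_def using assms
    by (intro far_mean_small[OF S_size[OF assms] S_plus_R]) linarith+
qed

lemma P_small:
  assumes "real n \<le> y" "y \<le> real T / 2"
  shows "P (nat \<lfloor>real T - y\<rfloor>) \<le> \<eta> - \<rho>"
proof -
  have "real (nat \<lfloor>real T - y\<rfloor>) > real T - y - 1" "real (nat \<lfloor>real T - y\<rfloor>) \<le> real T - y"
    using assms n by linarith+
  \<comment> \<open>The floor is above T/2 - 1, which is at least T/3 once T \<ge> 6. Smaller T
    start at 3 because T > 2n \<ge> 2, and there integrality of the floor is needed; equality occurs
    for T = 3.\<close>
  moreover have "nat \<lfloor>real T - y\<rfloor> \<ge> real T / 3"
  proof (cases "T = 3 \<or> T = 4 \<or> T = 5")
    case True
    have "T \<le> 2 * nat \<lfloor>real T - y\<rfloor> + 1" using assms by linarith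
    then show ?thesis using True by auto
  next
    case False
    then have "6 \<le> T" using n by linarith
    then show ?thesis using calculation assms by linarith
  qed
  moreover have "nat \<lfloor>real T - y\<rfloor> \<le> T" using assms by linarith
  ultimately show ?thesis unfolding P_def using assms S_plus_R[of "nat \<lfloor>real T - y\<rfloor>"]
    by (intro far_mean_small[OF R_size[OF assms]]) (auto simp: add.commute)
qed

text \<open>The near average is the left one for t \<le> T/2 and the right one otherwise. The band
  is used only at the integer points t and T - t, so there is no rounding loss.\<close>

lemma wiener_band_imp_statistic:
  assumes "\<And>x. real n \<le> x \<Longrightarrow> x \<le> real T / 2 \<Longrightarrow> sqrt (real n) * \<bar>w1 x\<bar> / x \<le> a"
    and "\<And>x. real n \<le> x \<Longrightarrow> x \<le> real T / 2 \<Longrightarrow> sqrt (real n) * \<bar>w2 x\<bar> / x \<le> a"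
    and t: "t \<in> {n..T - n}"
  shows "sqrt (real n) * d t / \<sigma> \<le> a + \<eta>"
proof -
  have tT: "t \<le> T" using t by auto
  have "P t + Q t \<le> a + \<eta>"
  proof (cases "real t \<le> real T / 2")
    case True
    have "P t \<le> a + \<rho>" using S_error[of "real t"] assms(1)[of "real t"] True t by (simp add: P_def)
    moreover have "Q t \<le> \<eta> - \<rho>" using Q_small[of "real t"] True t by simp
    ultimately show ?thesis by simp
  next
    case False
    have y: "real n \<le> real T - real t" "real T - real t \<le> real T / 2" "real T - (real T - real t) = real t"
      using False t n by (auto simp: of_nat_diff)
    have "Q t \<le> a + \<rho>" using R_error[OF y(1,2)] assms(2)[OF y(1,2)] by (simp add: y(3) Q_def)
    moreover have "P t \<le> \<eta> - \<rho>" using P_small[OF y(1,2)] by (simp add: y(3))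
    ultimately show ?thesis by simp
  qed
  then show ?thesis using d_bounds(1)[OF tT] by linarith
qed

text \<open>Here the bound at integers must reach every real x. For \<open>w1\<close> rounding down
  helps, as the integer denominator is at most x. For \<open>w2\<close> the denominator may be as
  large as x + 1, and (x + 1)/x \<le> 1 + 1/n is the origin of the factor.\<close>

lemma statistic_imp_wiener_band:
  assumes d: "\<And>t. t \<in> {n..T - n} \<Longrightarrow> sqrt (real n) * d t / \<sigma> \<le> a"
    and x: "real n \<le> x" "x \<le> real T / 2"
  shows "sqrt (real n) * \<bar>w1 x\<bar> / x \<le> (1 + 1 / real n) * (a + \<eta>)"
    and "sqrt (real n) * \<bar>w2 x\<bar> / x \<le> (1 + 1 / real n) * (a + \<eta>)"
proof -
  have x0: "0 < x" "0 < real n" using x n by auto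
  have le: "v \<le> (1 + 1 / real n) * v" if "0 \<le> v" for v
    using that by (simp add: distrib_right)
  show "sqrt (real n) * \<bar>w1 x\<bar> / x \<le> (1 + 1 / real n) * (a + \<eta>)"
  proof -
    let ?t = "nat \<lfloor>x\<rfloor>"
    have t: "?t \<in> {n..T - n}" "real ?t \<le> x" "0 < real ?t" "?t \<le> T" using x n by (auto, linarith+)
    have "P ?t \<le> a + (\<eta> - \<rho>)" using d_bounds(2)[OF t(4)] d[OF t(1)] Q_small[OF x] by linarith
    moreover have "sqrt (real n) * \<bar>S ?t\<bar> / (\<sigma> * x) \<le> P ?t" unfolding P_def
      using t x0 \<sigma> by (intro divide_left_mono mult_left_mono) auto
    ultimately have *: "sqrt (real n) * \<bar>w1 x\<bar> / x \<le> a + \<eta>" using S_error[OF x] by linarith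
    moreover have "0 \<le> sqrt (real n) * \<bar>w1 x\<bar> / x" using x0 by simp
    ultimately show ?thesis using le[of "a + \<eta>"] by linarith
  qed
  show "sqrt (real n) * \<bar>w2 x\<bar> / x \<le> (1 + 1 / real n) * (a + \<eta>)"
  proof -
    let ?t = "nat \<lfloor>real T - x\<rfloor>"
    have t: "?t \<in> {n..T - n}" "real T - real ?t \<le> x + 1" "x \<le> real T - real ?t" "?t \<le> T"
      using x n by (auto, linarith+)
    have Qa: "Q ?t \<le> a + (\<eta> - \<rho>)" using d_bounds(2)[OF t(4)] d[OF t(1)] P_small[OF x] by linarith
    have Q0: "0 \<le> Q ?t" using t x0 \<sigma> by (simp add: Q_def)
    have "sqrt (real n) * \<bar>R ?t\<bar> / (\<sigma> * x) = (real T - real ?t) / x * Q ?t"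
      using t x0 by (simp add: Q_def)
    also have "\<dots> \<le> (x + 1) / x * Q ?t"
      using t x0 Q0 by (intro mult_right_mono divide_right_mono) auto
    also have "\<dots> \<le> (1 + 1 / real n) * Q ?t"
      using x x0 Q0 by (intro mult_right_mono) (auto simp: add_divide_distrib divide_left_mono)
    also have "\<dots> \<le> (1 + 1 / real n) * (a + (\<eta> - \<rho>))"
      using Qa x0 by (intro mult_left_mono) auto
    finally have "sqrt (real n) * \<bar>w2 x\<bar> / x \<le> (1 + 1 / real n) * (a + (\<eta> - \<rho>)) + \<rho>"
      using R_error[OF x] by linarith
    also have "\<dots> \<le> (1 + 1 / real n) * (a + (\<eta> - \<rho>)) + (1 + 1 / real n) * \<rho>"
      using le[OF \<rho>_nonneg] by linarith
    finally show ?thesis by (simp add: distrib_left[symmetric])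
  qed
qed

end

section \<open>Weak convergence\<close>

lemma continuous_linear_envelope:
  fixes b :: "real \<Rightarrow> real"
  assumes b: "continuous_on {0..1} b" "b 0 = 0" and \<epsilon>: "0 < \<epsilon>"
  shows "\<exists>m::nat. \<forall>u\<in>{0..1}. \<bar>b u\<bar> \<le> \<epsilon> * (1 + real m * u)"
proof -
  obtain h where h: "0 < h" "\<And>u. u \<in> {0..1} \<Longrightarrow> u < h \<Longrightarrow> \<bar>b u\<bar> < \<epsilon>"
    using b(1) \<epsilon> b(2) unfolding continuous_on_iff by (force simp: dist_real_def)
  have "compact (b ` {0..1})" using b(1) by (intro compact_continuous_image) auto
  then obtain K where K: "\<And>u. u \<in> {0..1} \<Longrightarrow> \<bar>b u\<bar> \<le> K"
    using compact_imp_bounded bounded_iff by (metis imageI real_norm_def)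
  \<comment> \<open>Below \<open>h\<close> the constant term \<epsilon> is enough by continuity at
    0; \<open>m\<close> is so large that from \<open>h\<close> on the line has passed the global
    bound \<open>K\<close>.\<close>
  obtain m :: nat where m: "K / (h * \<epsilon>) < real m" using reals_Archimedean2 by blast
  have "\<bar>b u\<bar> \<le> \<epsilon> * (1 + real m * u)" if u: "u \<in> {0..1}" for u
  proof (cases "u < h")
    case True
    have "\<epsilon> * 1 \<le> \<epsilon> * (1 + real m * u)" using \<epsilon> u by (intro mult_left_mono) auto
    then show ?thesis using h(2)[OF u True] by linarith
  next
    case False
    have "K \<le> real m * (h * \<epsilon>)" using m h(1) \<epsilon> by (simp add: pos_divide_less_eq)
    also have "\<dots> = \<epsilon> * (real m * h)" by simp
    also have "\<dots> \<le> \<epsilon> * (1 + real m * u)"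
      using False \<epsilon> mult_left_mono[of h u "real m"] by (intro mult_left_mono) auto
    finally show ?thesis using K[OF u] by linarith
  qed
  then show ?thesis by blast
qed

lemma pair_band_mono:
  assumes "I \<subseteq> J" "\<And>x. x \<in> I \<Longrightarrow> h x \<le> k x"
  shows "pair_band M W1 W2 J h \<subseteq> pair_band M W1 W2 I k"
  using assms by (force simp: pair_band_def)

text \<open>Continuity from above along left ends 1/(m + 2), then monotonicity for all smaller left
  ends. This restores the time interval that inversion leaves out next to 0.\<close>

lemma pair_band_near_zero:
  assumes N: "prob_space N" and B: "wiener_on N 1 B1" "wiener_on N 1 B2" and \<gamma>: "0 < \<gamma>"
  shows "\<exists>\<delta>>0. \<forall>\<alpha>. 0 < \<alpha> \<longrightarrow> \<alpha> \<le> \<delta> \<longrightarrow>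
    measure N (pair_band N B1 B2 {\<alpha>..1} (\<lambda>_. a)) \<le> measure N (pair_band N B1 B2 {0..1} (\<lambda>_. a)) + \<gamma>"
proof -
  interpret prob_space N by fact
  \<comment> \<open>The shift by 2 keeps the left end below 1, as measurability of the band requires
    a nondegenerate interval.\<close>
  define E where "E m = pair_band N B1 B2 {1 / real (m + 2)..1} (\<lambda>_. a)" for m
  have sets: "pair_band N B1 B2 {\<alpha>..1} (\<lambda>_. a) \<in> sets N" if "0 \<le> \<alpha>" "\<alpha> < 1" for \<alpha>
    using that by (intro pair_band_sets[OF B]) auto
  have "(\<lambda>m. measure N (E m)) \<longlonglongrightarrow> measure N (\<Inter>m. E m)"
  proof (rule finite_Lim_measure_decseq)
    show "range E \<subseteq> sets N" unfolding E_def by (auto intro!: sets)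
    show "decseq E" unfolding decseq_def E_def
      by (intro allI impI pair_band_mono) (auto simp: frac_le)
  qed
  moreover have "(\<Inter>m. E m) = pair_band N B1 B2 {0..1} (\<lambda>_. a)"
  proof
    show "(\<Inter>m. E m) \<subseteq> pair_band N B1 B2 {0..1} (\<lambda>_. a)"
    proof
      fix \<omega> assume \<omega>: "\<omega> \<in> (\<Inter>m. E m)"
      then have sp: "\<omega> \<in> space N" by (auto simp: E_def pair_band_def)
      have *: "\<bar>B1 u \<omega>\<bar> \<le> a \<and> \<bar>B2 u \<omega>\<bar> \<le> a" if u: "0 < u" "u \<le> 1" for u
      proof -
        obtain m :: nat where "1 / u < real m" using reals_Archimedean2 by blast
        then have "1 / u \<le> real (m + 2)" by simp
        then have "1 / real (m + 2) \<le> u" using u by (simp add: field_simps)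
        then show ?thesis using \<omega> u by (force simp: E_def pair_band_def)
      qed
      \<comment> \<open>The sign of \<open>a\<close> is not given; it follows from the band at time
        1 and lets the time 0, where both paths vanish, be added.\<close>
      have "0 \<le> a" using *[of 1] by linarith
      then have "\<bar>B1 u \<omega>\<bar> \<le> a \<and> \<bar>B2 u \<omega>\<bar> \<le> a" if "u \<in> {0..1}" for u
        using *[of u] that wiener_on_zero[OF B(1) sp] wiener_on_zero[OF B(2) sp] by (cases "u = 0") auto
      then show "\<omega> \<in> pair_band N B1 B2 {0..1} (\<lambda>_. a)" using sp by (auto simp: pair_band_def)
    qed
    show "pair_band N B1 B2 {0..1} (\<lambda>_. a) \<subseteq> (\<Inter>m. E m)"
      unfolding E_def by (intro INT_greatest pair_band_mono) simp_all
  qed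
  ultimately have "(\<lambda>m. measure N (E m)) \<longlonglongrightarrow> measure N (pair_band N B1 B2 {0..1} (\<lambda>_. a))" by simp
  then have "eventually (\<lambda>m. measure N (E m) < measure N (pair_band N B1 B2 {0..1} (\<lambda>_. a)) + \<gamma>) sequentially"
    using \<gamma> by (intro order_tendstoD) auto
  then obtain m where m: "measure N (E m) < measure N (pair_band N B1 B2 {0..1} (\<lambda>_. a)) + \<gamma>"
    by (auto simp: eventually_sequentially)
  show ?thesis
  proof (intro exI[of _ "1 / real (m + 2)"] conjI allI impI)
    fix \<alpha> assume \<alpha>: "0 < \<alpha>" "\<alpha> \<le> 1 / real (m + 2)"
    have "measure N (pair_band N B1 B2 {\<alpha>..1} (\<lambda>_. a)) \<le> measure N (E m)"
      unfolding E_def using \<alpha> by (intro finite_measure_mono sets pair_band_mono) auto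
    then show "measure N (pair_band N B1 B2 {\<alpha>..1} (\<lambda>_. a)) \<le> measure N (pair_band N B1 B2 {0..1} (\<lambda>_. a)) + \<gamma>"
      using m by linarith
  qed simp
qed

text \<open>Every outcome lies in one of these events, which increase with \<open>m\<close>, so
  continuity from below yields one slope that works with probability close to 1.\<close>

lemma pair_band_linear_envelope:
  assumes N: "prob_space N" and B: "wiener_on N 1 B1" "wiener_on N 1 B2" and \<epsilon>: "0 < \<epsilon>" and \<gamma>: "0 < \<gamma>"
  shows "\<exists>m::nat. 1 - \<gamma> \<le> measure N (pair_band N B1 B2 {0..1} (\<lambda>u. \<epsilon> * (1 + real m * u)))"
proof -
  interpret prob_space N by fact
  define E where "E m = pair_band N B1 B2 {0..1} (\<lambda>u. \<epsilon> * (1 + real m * u))" for m :: nat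
  have mono: "E m \<subseteq> E k" if "m \<le> k" for m k
    unfolding E_def using that \<epsilon> by (intro pair_band_mono mult_left_mono add_left_mono mult_right_mono) auto
  have "(\<lambda>m. measure N (E m)) \<longlonglongrightarrow> measure N (\<Union>m. E m)"
  proof (rule finite_Lim_measure_incseq)
    show "range E \<subseteq> sets N" unfolding E_def
      by (auto intro!: pair_band_sets[OF B] continuous_intros)
    show "incseq E" using mono by (auto simp: incseq_def)
  qed
  moreover have "(\<Union>m. E m) = space N"
  proof
    show "space N \<subseteq> (\<Union>m. E m)"
    proof
      fix \<omega> assume sp: "\<omega> \<in> space N"
      obtain m1 where m1: "\<And>u. u \<in> {0..1} \<Longrightarrow> \<bar>B1 u \<omega>\<bar> \<le> \<epsilon> * (1 + real m1 * u)"
        using continuous_linear_envelope[OF wiener_on_continuous[OF B(1) sp] wiener_on_zero[OF B(1) sp] \<epsilon>] by blast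
      obtain m2 where m2: "\<And>u. u \<in> {0..1} \<Longrightarrow> \<bar>B2 u \<omega>\<bar> \<le> \<epsilon> * (1 + real m2 * u)"
        using continuous_linear_envelope[OF wiener_on_continuous[OF B(2) sp] wiener_on_zero[OF B(2) sp] \<epsilon>] by blast
      have le: "\<epsilon> * (1 + real k * u) \<le> \<epsilon> * (1 + real (max m1 m2) * u)" if "k \<le> max m1 m2" "u \<in> {0..1}" for k u
        using that \<epsilon> by (intro mult_left_mono add_left_mono mult_right_mono) auto
      have "\<omega> \<in> E (max m1 m2)" unfolding E_def pair_band_def
        using order_trans[OF m1 le[of m1]] order_trans[OF m2 le[of m2]] sp by auto
      then show "\<omega> \<in> (\<Union>m. E m)" by blast
    qed
  qed (auto simp: E_def pair_band_def)
  ultimately have "(\<lambda>m. measure N (E m)) \<longlonglongrightarrow> 1" by (simp add: prob_space)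
  then have "eventually (\<lambda>m. 1 - \<gamma> < measure N (E m)) sequentially"
    using \<gamma> by (intro order_tendstoD) auto
  then show ?thesis unfolding E_def by (auto simp: eventually_sequentially intro: less_imp_le)
qed

lemma pair_sup_le_iff:
  assumes B: "wiener_on N 1 B1" "wiener_on N 1 B2" and \<omega>: "\<omega> \<in> space N"
  shows "max (SUP u\<in>{0..1}. \<bar>B1 u \<omega>\<bar>) (SUP u\<in>{0..1}. \<bar>B2 u \<omega>\<bar>) \<le> a \<longleftrightarrow>
    \<omega> \<in> pair_band N B1 B2 {0..1} (\<lambda>_. a)"
proof -
  have "(SUP u\<in>{0..1}. \<bar>B u \<omega>\<bar>) \<le> a \<longleftrightarrow> (\<forall>u\<in>{0..1}. \<bar>B u \<omega>\<bar> \<le> a)" if "wiener_on N 1 B" for B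
  proof (rule cSUP_le_iff)
    have "compact ((\<lambda>u. \<bar>B u \<omega>\<bar>) ` {0..1})"
      using wiener_on_continuous[OF that \<omega>] by (intro compact_continuous_image continuous_intros) auto
    then show "bdd_above ((\<lambda>u. \<bar>B u \<omega>\<bar>) ` {0..1})" by (intro bounded_imp_bdd_above compact_imp_bounded)
  qed simp
  then show ?thesis using B \<omega> by (simp add: pair_band_def)
qed

lemma cdf_pair_sup:
  assumes N: "prob_space N" and B: "wiener_on N 1 B1" "wiener_on N 1 B2"
  defines "\<xi> \<equiv> \<lambda>\<omega>. max (SUP u\<in>{0..1}. \<bar>B1 u \<omega>\<bar>) (SUP u\<in>{0..1}. \<bar>B2 u \<omega>\<bar>)"
  shows "\<xi> \<in> borel_measurable N"
    and "cdf (distr N borel \<xi>) a = measure N (pair_band N B1 B2 {0..1} (\<lambda>_. a))"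
proof -
  have eq: "{\<omega> \<in> space N. \<xi> \<omega> \<le> a} = pair_band N B1 B2 {0..1} (\<lambda>_. a)" for a
  proof -
    have "{\<omega> \<in> space N. \<xi> \<omega> \<le> a} = {\<omega> \<in> space N. \<omega> \<in> pair_band N B1 B2 {0..1} (\<lambda>_. a)}"
      unfolding \<xi>_def using pair_sup_le_iff[OF B] by (intro Collect_cong conj_cong) auto
    then show ?thesis by (auto simp: pair_band_def)
  qed
  show m: "\<xi> \<in> borel_measurable N"
    unfolding borel_measurable_iff_le eq by (intro allI pair_band_sets[OF B]) auto
  show "cdf (distr N borel \<xi>) a = measure N (pair_band N B1 B2 {0..1} (\<lambda>_. a))"
    unfolding cdf_def eq[symmetric] using m by (simp add: measure_distr vimage_def Int_def conj_commute)
qed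

section \<open>From bounds in probability to pathwise bounds\<close>

text \<open>A real supremum bounds the values only if they are bounded above. The constants
  \<open>K\<close> and \<open>K'\<close> secure this: for each fixed path the partial sums and the
  Wiener path are bounded.\<close>

lemma SUP_powr_boundD:
  fixes p s w :: "'x \<Rightarrow> real"
  assumes sup: "\<bar>SUP x\<in>X. p x powr (- \<kappa>) * \<bar>s x - \<sigma> * w x\<bar>\<bar> \<le> C"
    and p: "\<And>x. x \<in> X \<Longrightarrow> 1 \<le> p x" and s: "\<And>x. x \<in> X \<Longrightarrow> \<bar>s x\<bar> \<le> K" and w: "\<And>x. x \<in> X \<Longrightarrow> \<bar>w x\<bar> \<le> K'"
    and \<kappa>: "0 < \<kappa>" and x: "x \<in> X"
  shows "\<bar>s x - \<sigma> * w x\<bar> \<le> C * p x powr \<kappa>"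
proof -
  have "bdd_above ((\<lambda>x. p x powr (- \<kappa>) * \<bar>s x - \<sigma> * w x\<bar>) ` X)"
  proof (rule bdd_aboveI2)
    fix x assume x: "x \<in> X"
    have "p x powr (- \<kappa>) \<le> p x powr 0" using p[OF x] \<kappa> by (intro powr_mono) auto
    then have "p x powr (- \<kappa>) \<le> 1" using p[OF x] by simp
    then have "p x powr (- \<kappa>) * \<bar>s x - \<sigma> * w x\<bar> \<le> 1 * \<bar>s x - \<sigma> * w x\<bar>" by (intro mult_right_mono) auto
    also have "\<dots> \<le> \<bar>s x\<bar> + \<bar>\<sigma>\<bar> * \<bar>w x\<bar>" by (simp add: abs_mult[symmetric])
    also have "\<dots> \<le> K + \<bar>\<sigma>\<bar> * K'" using s[OF x] w[OF x] by (intro add_mono mult_left_mono) auto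
    finally show "p x powr (- \<kappa>) * \<bar>s x - \<sigma> * w x\<bar> \<le> K + \<bar>\<sigma>\<bar> * K'" .
  qed
  then have "p x powr (- \<kappa>) * \<bar>s x - \<sigma> * w x\<bar> \<le> (SUP x\<in>X. p x powr (- \<kappa>) * \<bar>s x - \<sigma> * w x\<bar>)"
    using x by (rule cSUP_upper[rotated])
  then have "p x powr (- \<kappa>) * \<bar>s x - \<sigma> * w x\<bar> \<le> C" using sup by linarith
  then have "p x powr \<kappa> * (p x powr (- \<kappa>) * \<bar>s x - \<sigma> * w x\<bar>) \<le> p x powr \<kappa> * C"
    by (intro mult_left_mono) auto
  moreover have "p x powr \<kappa> * p x powr (- \<kappa>) = 1" using p[OF x] by (simp add: powr_add[symmetric])
  ultimately show ?thesis by (simp add: mult.assoc[symmetric] mult.commute)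
qed

lemma sum_abs_le_prefix:
  fixes e :: "nat \<Rightarrow> real"
  assumes "A \<subseteq> {1..T}"
  shows "\<bar>sum e A\<bar> \<le> (\<Sum>s=1..T. \<bar>e s\<bar>)"
proof -
  have "\<bar>sum e A\<bar> \<le> (\<Sum>s\<in>A. \<bar>e s\<bar>)" by (rule sum_abs)
  also have "\<dots> \<le> (\<Sum>s=1..T. \<bar>e s\<bar>)" by (rule sum_mono2) (use assms in auto)
  finally show ?thesis .
qed

lemma (in prob_space) prob_Int_lower:
  assumes "A \<in> events" "B \<in> events"
  shows "prob A + prob B - 1 \<le> prob (A \<inter> B)"
proof -
  have "prob A \<le> prob (A \<inter> B \<union> (space M - B))"
    using assms sets.sets_into_space[OF assms(1)] by (intro finite_measure_mono) auto
  also have "\<dots> \<le> prob (A \<inter> B) + prob (space M - B)"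
    using assms by (intro measure_Un_le) auto
  finally show ?thesis using prob_compl[OF assms(2)] by simp
qed

section \<open>Likely events and convergence of the distribution functions\<close>

locale trimmed_approximation = M: prob_space M + N: prob_space N
  for M :: "'a measure" and N :: "'b measure" +
  fixes mu :: "nat \<Rightarrow> real" and e :: "nat \<Rightarrow> 'a \<Rightarrow> real"
    and tT :: "nat \<Rightarrow> nat"
    and \<sigma> \<kappa> :: real
    and W1 W2 :: "nat \<Rightarrow> real \<Rightarrow> 'a \<Rightarrow> real"
    and B1 B2 :: "real \<Rightarrow> 'b \<Rightarrow> real"
  assumes e_rv: "\<And>s. s \<ge> 1 \<Longrightarrow> e s \<in> borel_measurable M"
    and H0: "\<And>s t. s \<ge> 1 \<Longrightarrow> t \<ge> 1 \<Longrightarrow> mu s = mu t"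
    and trim_inf: "filterlim tT at_top sequentially"
    and trim_small: "(\<lambda>T. real (tT T) / real T) \<longlonglongrightarrow> 0"
    and sigma_pos: "\<sigma> > 0"
    and kappa: "0 < \<kappa>" "\<kappa> < 1/2"
    and W1_wiener: "\<And>T. wiener_on M (real T / 2) (W1 T)"
    and W2_wiener: "\<And>T. wiener_on M (real T / 2) (W2 T)"
    and W12_indep: "\<And>T. indep_processes M (real T / 2) (W1 T) (W2 T)"
    and approx1: "bounded_in_prob M (\<lambda>T \<omega>.
        SUP x\<in>{1..real T / 2}. x powr (-\<kappa>) *
          \<bar>(\<Sum>s=1..nat \<lfloor>x\<rfloor>. e s \<omega>) - \<sigma> * W1 T x \<omega>\<bar>)"
    and approx2: "bounded_in_prob M (\<lambda>T \<omega>.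
        SUP x\<in>{real T / 2..real T - 1}. (real T - x) powr (-\<kappa>) *
          \<bar>(\<Sum>s=nat \<lfloor>x\<rfloor>+1..T. e s \<omega>) - \<sigma> * W2 T (real T - x) \<omega>\<bar>)"
    and B1_wiener: "wiener_on N 1 B1"
    and B2_wiener: "wiener_on N 1 B2"
    and B12_indep: "indep_processes N 1 B1 B2"
begin

definition stat :: "nat \<Rightarrow> 'a \<Rightarrow> real" where
  "stat T \<omega> = sqrt (real (tT T)) * D_stat (\<lambda>s \<omega>. mu s + e s \<omega>) (tT T) T \<omega> / \<sigma>"

definition W_band :: "nat \<Rightarrow> real \<Rightarrow> 'a set" where
  "W_band T a = pair_band M (W1 T) (W2 T) {real (tT T)..real T / 2} (\<lambda>x. x / sqrt (real (tT T)) * a)"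

text \<open>The barrier equals \<epsilon>T / sqrt n with n = \<open>tT T\<close>. It is left
  unsimplified so that it is literally the inverted form of the line g u = \<epsilon>(T/n)u.\<close>

definition small_band :: "nat \<Rightarrow> real \<Rightarrow> 'a set" where
  "small_band T \<epsilon> = pair_band M (W1 T) (W2 T) {real (tT T)..real T / 2}
     (\<lambda>x. x / sqrt (real (tT T)) * (\<epsilon> * (real T / real (tT T)) * (real (tT T) / x)))"

definition good_approx :: "nat \<Rightarrow> real \<Rightarrow> 'a \<Rightarrow> bool" where
  "good_approx T C \<omega> \<longleftrightarrow>
    (\<forall>x. 1 \<le> x \<longrightarrow> x \<le> real T / 2 \<longrightarrow>
      \<bar>(\<Sum>s=1..nat \<lfloor>x\<rfloor>. e s \<omega>) - \<sigma> * W1 T x \<omega>\<bar> \<le> C * x powr \<kappa>) \<and>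
    (\<forall>x. real T / 2 \<le> x \<longrightarrow> x \<le> real T - 1 \<longrightarrow>
      \<bar>(\<Sum>s=nat \<lfloor>x\<rfloor>+1..T. e s \<omega>) - \<sigma> * W2 T (real T - x) \<omega>\<bar> \<le> C * (real T - x) powr \<kappa>)"

lemma eventually_fraction_le:
  assumes "0 < \<delta>"
  shows "eventually (\<lambda>T. 1 \<le> tT T \<and> 2 * tT T < T \<and> real (tT T) / (real T / 2) \<le> \<delta>) sequentially"
proof -
  have "eventually (\<lambda>T. real (tT T) / real T < min (1/2) (\<delta>/2)) sequentially"
    using trim_small assms by (intro order_tendstoD) auto
  moreover have "eventually (\<lambda>T. 1 \<le> tT T) sequentially"
    using trim_inf by (simp add: filterlim_at_top)
  moreover have "eventually (\<lambda>T. 1 \<le> T) sequentially" by (rule eventually_ge_at_top)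
  ultimately show ?thesis
  proof eventually_elim
    case (elim T)
    then have "2 * real (tT T) < real T" by (simp add: field_simps)
    moreover have "real (tT T) / (real T / 2) \<le> \<delta>" using elim by (simp add: field_simps)
    ultimately show ?case using elim by linarith
  qed
qed

lemma measure_W_band:
  assumes "1 \<le> tT T" "2 * tT T < T"
  shows "W_band T a \<in> sets M"
    and "measure M (W_band T a) = measure N (pair_band N B1 B2 {real (tT T) / (real T / 2)..1} (\<lambda>_. a))"
  unfolding W_band_def
proof -
  show "pair_band M (W1 T) (W2 T) {real (tT T)..real T / 2} (\<lambda>x. x / sqrt (real (tT T)) * a) \<in> sets M"
    using assms by (intro pair_band_sets[OF W1_wiener W2_wiener] continuous_intros) auto
  show "measure M (pair_band M (W1 T) (W2 T) {real (tT T)..real T / 2} (\<lambda>x. x / sqrt (real (tT T)) * a)) =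
    measure N (pair_band N B1 B2 {real (tT T) / (real T / 2)..1} (\<lambda>_. a))"
    using assms by (intro time_inversion_band2[OF M.prob_space_axioms W1_wiener W2_wiener W12_indep
          N.prob_space_axioms B1_wiener B2_wiener B12_indep, where g="\<lambda>_. a"]) auto
qed

text \<open>By inversion this is the probability that \<open>B1\<close> and \<open>B2\<close> stay
  below the line \<epsilon>(T/n)u on [2n/T, 1]. Its slope grows without bound, so it eventually
  dominates there the fixed envelope \<epsilon>(1 + mu).\<close>

lemma small_band_probable:
  assumes \<epsilon>: "0 < \<epsilon>" and \<gamma>: "0 < \<gamma>"
  shows "eventually (\<lambda>T. small_band T \<epsilon> \<in> sets M \<and> 1 - \<gamma> \<le> measure M (small_band T \<epsilon>)) sequentially"
proof -
  obtain m :: nat where m: "1 - \<gamma> \<le> measure N (pair_band N B1 B2 {0..1} (\<lambda>u. \<epsilon> * (1 + real m * u)))"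
    using pair_band_linear_envelope[OF N.prob_space_axioms B1_wiener B2_wiener \<epsilon> \<gamma>] by blast
  have "eventually (\<lambda>T. 1 \<le> tT T \<and> 2 * tT T < T \<and> real (tT T) / (real T / 2) \<le> 1 / (real m + 1)) sequentially"
    by (rule eventually_fraction_le) simp
  then show ?thesis
  proof eventually_elim
    case (elim T)
    define n where "n = real (tT T)"
    have n: "0 < n" "n < real T / 2" "n / (real T / 2) \<le> 1 / (real m + 1)" using elim by (auto simp: n_def)
    let ?g = "\<lambda>u. \<epsilon> * (real T / n) * u"
    have "pair_band N B1 B2 {0..1} (\<lambda>u. \<epsilon> * (1 + real m * u)) \<subseteq> pair_band N B1 B2 {n / (real T / 2)..1} ?g"
    proof (rule pair_band_mono)
      show "{n / (real T / 2)..1} \<subseteq> {0..1}" using n by simp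
      fix u assume u: "u \<in> {n / (real T / 2)..1}"
      have u0: "0 \<le> u" using u n by (auto intro: order_trans[rotated])
      \<comment> \<open>Half of the steep line: on this interval y \<ge> 1, and y \<ge> mu because
        T/(2n) \<ge> m + 1. Hence 2y covers 1 + mu.\<close>
      define y where "y = real T / 2 / n * u"
      have "real m + 1 \<le> real T / 2 / n" using n by (simp add: field_simps)
      then have "real m * u \<le> y" unfolding y_def using u0 by (intro mult_right_mono) auto
      moreover have "1 \<le> y" using u n by (simp add: y_def field_simps)
      moreover have "real T / n * u = y + y" by (simp add: y_def)
      ultimately have "1 + real m * u \<le> real T / n * u" by linarith
      then show "\<epsilon> * (1 + real m * u) \<le> \<epsilon> * (real T / n) * u"
        using \<epsilon> mult_left_mono[of "1 + real m * u" "real T / n * u" \<epsilon>] by (simp add: mult.assoc)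
    qed
    then have "measure N (pair_band N B1 B2 {0..1} (\<lambda>u. \<epsilon> * (1 + real m * u))) \<le>
      measure N (pair_band N B1 B2 {n / (real T / 2)..1} ?g)"
      using n by (intro N.finite_measure_mono pair_band_sets[OF B1_wiener B2_wiener] continuous_intros) auto
    also have "\<dots> = measure M (small_band T \<epsilon>)"
      unfolding small_band_def n_def[symmetric] using n
      by (intro time_inversion_band2[OF M.prob_space_axioms W1_wiener W2_wiener W12_indep
          N.prob_space_axioms B1_wiener B2_wiener B12_indep, where g="?g", symmetric] continuous_intros) auto
    finally have "1 - \<gamma> \<le> measure M (small_band T \<epsilon>)" using m by linarith
    moreover have "small_band T \<epsilon> \<in> sets M" unfolding small_band_def n_def[symmetric] using n
      by (intro pair_band_sets[OF W1_wiener W2_wiener] continuous_intros) auto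
    ultimately show ?case by blast
  qed
qed

lemma W_bounded:
  assumes "\<omega> \<in> space M" "wiener_on M L W"
  shows "\<exists>K. \<forall>x\<in>{0..L}. \<bar>W x \<omega>\<bar> \<le> K"
proof -
  have "compact ((\<lambda>x. W x \<omega>) ` {0..L})"
    using wiener_on_continuous[OF assms(2,1)] by (intro compact_continuous_image) auto
  then show ?thesis using compact_imp_bounded bounded_iff by (metis imageI real_norm_def)
qed

lemma good_approx_probable:
  assumes \<gamma>: "0 < \<gamma>"
  shows "\<exists>C\<ge>0. eventually (\<lambda>T. \<exists>A\<in>sets M. 1 - \<gamma> \<le> measure M A \<and> (\<forall>\<omega>\<in>A. good_approx T C \<omega>)) sequentially"
proof -
  have \<gamma>2: "0 < \<gamma> / 2" using \<gamma> by simp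
  obtain C1 T1 where 1: "\<And>T. T \<ge> T1 \<Longrightarrow> \<exists>A\<in>sets M. measure M A \<ge> 1 - \<gamma> / 2 \<and> (\<forall>\<omega>\<in>A. \<bar>SUP x\<in>{1..real T / 2}.
      x powr (-\<kappa>) * \<bar>(\<Sum>s=1..nat \<lfloor>x\<rfloor>. e s \<omega>) - \<sigma> * W1 T x \<omega>\<bar>\<bar> \<le> C1)"
    using approx1 \<gamma>2 unfolding bounded_in_prob_def by blast
  obtain C2 T2 where 2: "\<And>T. T \<ge> T2 \<Longrightarrow> \<exists>A\<in>sets M. measure M A \<ge> 1 - \<gamma> / 2 \<and> (\<forall>\<omega>\<in>A. \<bar>SUP x\<in>{real T / 2..real T - 1}.
      (real T - x) powr (-\<kappa>) * \<bar>(\<Sum>s=nat \<lfloor>x\<rfloor>+1..T. e s \<omega>) - \<sigma> * W2 T (real T - x) \<omega>\<bar>\<bar> \<le> C2)"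
    using approx2 \<gamma>2 unfolding bounded_in_prob_def by blast
  define C where "C = max 0 (max C1 C2)"
  have C: "0 \<le> C" "C1 \<le> C" "C2 \<le> C" by (auto simp: C_def)
  have "\<exists>A\<in>sets M. 1 - \<gamma> \<le> measure M A \<and> (\<forall>\<omega>\<in>A. good_approx T C \<omega>)" if T: "T \<ge> max T1 T2" for T
  proof -
    obtain A1 where A1: "A1 \<in> sets M" "measure M A1 \<ge> 1 - \<gamma> / 2" "\<And>\<omega>. \<omega> \<in> A1 \<Longrightarrow> \<bar>SUP x\<in>{1..real T / 2}.
      x powr (-\<kappa>) * \<bar>(\<Sum>s=1..nat \<lfloor>x\<rfloor>. e s \<omega>) - \<sigma> * W1 T x \<omega>\<bar>\<bar> \<le> C1"
      using 1[of T] T by auto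
    obtain A2 where A2: "A2 \<in> sets M" "measure M A2 \<ge> 1 - \<gamma> / 2" "\<And>\<omega>. \<omega> \<in> A2 \<Longrightarrow> \<bar>SUP x\<in>{real T / 2..real T - 1}.
      (real T - x) powr (-\<kappa>) * \<bar>(\<Sum>s=nat \<lfloor>x\<rfloor>+1..T. e s \<omega>) - \<sigma> * W2 T (real T - x) \<omega>\<bar>\<bar> \<le> C2"
      using 2[of T] T by auto
    have "good_approx T C \<omega>" if \<omega>: "\<omega> \<in> A1 \<inter> A2" for \<omega>
    proof -
      have sp: "\<omega> \<in> space M" using \<omega> A1(1) sets.sets_into_space by blast
      obtain K1 where K1: "\<And>x. x \<in> {0..real T / 2} \<Longrightarrow> \<bar>W1 T x \<omega>\<bar> \<le> K1"
        using W_bounded[OF sp W1_wiener] by blast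
      obtain K2 where K2: "\<And>x. x \<in> {0..real T / 2} \<Longrightarrow> \<bar>W2 T x \<omega>\<bar> \<le> K2"
        using W_bounded[OF sp W2_wiener] by blast
      have "\<bar>(\<Sum>s=1..nat \<lfloor>x\<rfloor>. e s \<omega>) - \<sigma> * W1 T x \<omega>\<bar> \<le> C * x powr \<kappa>" if x: "1 \<le> x" "x \<le> real T / 2" for x
      proof -
        have "\<bar>(\<Sum>s=1..nat \<lfloor>x\<rfloor>. e s \<omega>) - \<sigma> * W1 T x \<omega>\<bar> \<le> C1 * x powr \<kappa>"
        proof (rule SUP_powr_boundD[where p="\<lambda>x. x" and X="{1..real T / 2}" and K'=K1])
          fix y assume "y \<in> {1..real T / 2}"
          then have "nat \<lfloor>y\<rfloor> \<le> T" by (simp, linarith)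
          then show "\<bar>\<Sum>s=1..nat \<lfloor>y\<rfloor>. e s \<omega>\<bar> \<le> (\<Sum>s=1..T. \<bar>e s \<omega>\<bar>)"
            by (intro sum_abs_le_prefix) auto
        qed (use A1(3) \<omega> x K1 kappa in auto)
        also have "\<dots> \<le> C * x powr \<kappa>" using C by (intro mult_right_mono) auto
        finally show ?thesis .
      qed
      moreover have "\<bar>(\<Sum>s=nat \<lfloor>x\<rfloor>+1..T. e s \<omega>) - \<sigma> * W2 T (real T - x) \<omega>\<bar> \<le> C * (real T - x) powr \<kappa>"
        if x: "real T / 2 \<le> x" "x \<le> real T - 1" for x
      proof -
        have "\<bar>(\<Sum>s=nat \<lfloor>x\<rfloor>+1..T. e s \<omega>) - \<sigma> * W2 T (real T - x) \<omega>\<bar> \<le> C2 * (real T - x) powr \<kappa>"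
        proof (rule SUP_powr_boundD[where p="\<lambda>x. real T - x" and X="{real T / 2..real T - 1}" and K'=K2])
          fix y assume "y \<in> {real T / 2..real T - 1}"
          show "\<bar>\<Sum>s=nat \<lfloor>y\<rfloor>+1..T. e s \<omega>\<bar> \<le> (\<Sum>s=1..T. \<bar>e s \<omega>\<bar>)"
            by (intro sum_abs_le_prefix) auto
        qed (use A2(3) \<omega> x K2 kappa in auto)
        also have "\<dots> \<le> C * (real T - x) powr \<kappa>" using C by (intro mult_right_mono) auto
        finally show ?thesis .
      qed
      ultimately show ?thesis by (simp add: good_approx_def)
    qed
    moreover have "1 - \<gamma> \<le> measure M (A1 \<inter> A2)"
      using M.prob_Int_lower[OF A1(1) A2(1)] A1(2) A2(2) by linarith
    ultimately show ?thesis using A1(1) A2(1) by blast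
  qed
  then have "eventually (\<lambda>T. \<exists>A\<in>sets M. 1 - \<gamma> \<le> measure M A \<and> (\<forall>\<omega>\<in>A. good_approx T C \<omega>)) sequentially"
    unfolding eventually_sequentially by blast
  with C(1) show ?thesis by blast
qed

lemma stat_measurable: "stat T \<in> borel_measurable M"
proof -
  have "(\<lambda>\<omega>. mu s + e s \<omega>) \<in> borel_measurable M" if "s \<ge> 1" for s using e_rv[OF that] by measurable
  then show ?thesis unfolding stat_def[abs_def] D_stat_def[abs_def]
    by (intro borel_measurable_divide borel_measurable_times borel_measurable_const borel_measurable_Max
        borel_measurable_abs borel_measurable_diff borel_measurable_sum) auto
qed

lemma stat_le_iff:
  assumes n: "1 \<le> tT T" "2 * tT T < T"
  shows "stat T \<omega> \<le> a \<longleftrightarrow> (\<forall>t\<in>{tT T..T - tT T}. sqrt (real (tT T)) *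
    \<bar>(1 / real t) * (\<Sum>s=1..t. e s \<omega>) - (1 / (real T - real t)) * (\<Sum>s=t+1..T. e s \<omega>)\<bar> / \<sigma> \<le> a)"
proof -
  let ?d = "\<lambda>t. \<bar>(1 / real t) * (\<Sum>s=1..t. e s \<omega>) - (1 / (real T - real t)) * (\<Sum>s=t+1..T. e s \<omega>)\<bar>"
  have mean: "(1 / real k) * (\<Sum>s\<in>A. mu s + e s \<omega>) = mu 1 + (1 / real k) * (\<Sum>s\<in>A. e s \<omega>)"
    if "A \<subseteq> {1..}" "card A = k" "0 < k" for k A
  proof -
    have "(\<Sum>s\<in>A. mu s) = (\<Sum>s\<in>A. mu 1)" using that(1) H0 by (intro sum.cong) auto
    then show ?thesis using that by (simp add: sum.distrib distrib_left)
  qed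
  have "D_stat (\<lambda>s \<omega>. mu s + e s \<omega>) (tT T) T \<omega> = Max (?d ` {tT T..T - tT T})"
    unfolding D_stat_def
  proof (intro arg_cong[where f=Max] image_cong refl)
    fix t assume t: "t \<in> {tT T..T - tT T}"
    then have "real T - real t = real (T - t)" "0 < t" "0 < T - t" using n by (auto simp: of_nat_diff)
    then show "\<bar>(1 / real t) * (\<Sum>s=1..t. mu s + e s \<omega>) - (1 / (real T - real t)) * (\<Sum>s=t+1..T. mu s + e s \<omega>)\<bar> = ?d t"
      using mean[of "{1..t}" t] mean[of "{t+1..T}" "T - t"] by simp
  qed
  then have stat: "stat T \<omega> = sqrt (real (tT T)) / \<sigma> * Max (?d ` {tT T..T - tT T})"
    by (simp add: stat_def)
  have k: "0 < sqrt (real (tT T)) / \<sigma>" using n sigma_pos by simp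
  have le: "sqrt (real (tT T)) / \<sigma> * x \<le> a \<longleftrightarrow> x \<le> a / (sqrt (real (tT T)) / \<sigma>)" for x
    by (simp only: pos_le_divide_eq[OF k] mult.commute)
  have ne: "{tT T..T - tT T} \<noteq> {}" using n by auto
  have "stat T \<omega> \<le> a \<longleftrightarrow> (\<forall>t\<in>{tT T..T - tT T}. ?d t \<le> a / (sqrt (real (tT T)) / \<sigma>))"
    unfolding stat le using ne by (subst Max_le_iff) auto
  then show ?thesis unfolding le[symmetric] by simp
qed

text \<open>Transfers the two deterministic inclusions to outcomes. Here \<open>\<eta>\<close> is
  any upper bound for the pathwise error, so that a bound free of T can be inserted later.\<close>

lemma good_paths:
  assumes n: "1 \<le> tT T" "2 * tT T < T" and \<omega>: "\<omega> \<in> space M" "\<omega> \<in> small_band T \<epsilon>" "good_approx T C \<omega>"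
    and C: "0 \<le> C"
    and \<eta>: "9 * \<epsilon> + 6 * (C / \<sigma> * real (tT T) powr (\<kappa> - 1/2)) \<le> \<eta>"
  shows "\<omega> \<in> W_band T b \<Longrightarrow> stat T \<omega> \<le> b + \<eta>"
    and "stat T \<omega> \<le> a \<Longrightarrow> (1 + 1 / real (tT T)) * (a + \<eta>) \<le> b \<Longrightarrow> \<omega> \<in> W_band T b"
proof -
  define n where "n = tT T"
  have n0: "0 < real n" using n by (simp add: n_def)
  have conv: "w \<le> x / sqrt (real n) * v \<longleftrightarrow> sqrt (real n) * w / x \<le> v" if "0 < x" for w x v
    using that n0 by (simp add: field_simps)
  have small: "sqrt (real n) * \<bar>w\<bar> \<le> \<epsilon> * real T"
    if x: "0 < x" and w: "\<bar>w\<bar> \<le> x / sqrt (real n) * (\<epsilon> * (real T / real n) * (real n / x))" for x w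
  proof -
    have "sqrt (real n) * \<bar>w\<bar> \<le> sqrt (real n) * (x / sqrt (real n) * (\<epsilon> * (real T / real n) * (real n / x)))"
      using w by (intro mult_left_mono) auto
    also have "\<dots> = \<epsilon> * real T" using x n0 by (simp add: field_simps)
    finally show ?thesis .
  qed
  have bands: "\<forall>x\<in>{real n..real T / 2}. \<bar>W1 T x \<omega>\<bar> \<le> x / sqrt (real n) * (\<epsilon> * (real T / real n) * (real n / x))"
    "\<forall>x\<in>{real n..real T / 2}. \<bar>W2 T x \<omega>\<bar> \<le> x / sqrt (real n) * (\<epsilon> * (real T / real n) * (real n / x))"
    using \<omega>(2) unfolding small_band_def pair_band_def n_def by blast+
  interpret P: approximated_path "\<lambda>s. e s \<omega>" "\<lambda>x. W1 T x \<omega>" "\<lambda>x. W2 T x \<omega>" n T C \<sigma> \<kappa> \<epsilon>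
  proof
    show "1 \<le> n" "2 * n < T" using n by (auto simp: n_def)
    fix x assume x: "real n \<le> x" "x \<le> real T / 2"
    then have x0: "0 < x" and xI: "x \<in> {real n..real T / 2}" using n0 by auto
    show "sqrt (real n) * \<bar>W1 T x \<omega>\<bar> \<le> \<epsilon> * real T" "sqrt (real n) * \<bar>W2 T x \<omega>\<bar> \<le> \<epsilon> * real T"
      by (rule small[OF x0 bspec[OF bands(1) xI]], rule small[OF x0 bspec[OF bands(2) xI]])
  qed (use \<omega>(3) C sigma_pos kappa in \<open>auto simp: good_approx_def\<close>)
  have stat: "stat T \<omega> \<le> v \<longleftrightarrow> (\<forall>t\<in>{n..T - n}. sqrt (real n) * P.d t / \<sigma> \<le> v)" for v
    unfolding stat_le_iff[OF n] P.d_def P.S_def P.R_def unfolding n_def ..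
  have \<eta>': "P.\<eta> \<le> \<eta>" using \<eta> unfolding P.\<eta>_def P.\<rho>_def unfolding n_def .
  show "stat T \<omega> \<le> b + \<eta>" if "\<omega> \<in> W_band T b"
  proof -
    have *: "sqrt (real n) * \<bar>W1 T x \<omega>\<bar> / x \<le> b" "sqrt (real n) * \<bar>W2 T x \<omega>\<bar> / x \<le> b"
      if x: "real n \<le> x" "x \<le> real T / 2" for x
    proof -
      have x0: "0 < x" using x n0 by linarith
      have "\<bar>W1 T x \<omega>\<bar> \<le> x / sqrt (real n) * b" "\<bar>W2 T x \<omega>\<bar> \<le> x / sqrt (real n) * b"
        using x \<open>\<omega> \<in> W_band T b\<close> unfolding W_band_def pair_band_def n_def by simp_all
      then show "sqrt (real n) * \<bar>W1 T x \<omega>\<bar> / x \<le> b" "sqrt (real n) * \<bar>W2 T x \<omega>\<bar> / x \<le> b"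
        unfolding conv[OF x0] .
    qed
    have "\<forall>t\<in>{n..T - n}. sqrt (real n) * P.d t / \<sigma> \<le> b + P.\<eta>"
      using P.wiener_band_imp_statistic[OF *] by blast
    then have "stat T \<omega> \<le> b + P.\<eta>" unfolding stat .
    then show ?thesis using \<eta>' by linarith
  qed
  show "\<omega> \<in> W_band T b" if a: "stat T \<omega> \<le> a" and b: "(1 + 1 / real (tT T)) * (a + \<eta>) \<le> b"
  proof -
    have "(1 + 1 / real n) * (a + P.\<eta>) \<le> (1 + 1 / real n) * (a + \<eta>)"
      using \<eta>' by (intro mult_left_mono) auto
    then have b': "(1 + 1 / real n) * (a + P.\<eta>) \<le> b" using b unfolding n_def by linarith
    have d: "sqrt (real n) * P.d t / \<sigma> \<le> a" if "t \<in> {n..T - n}" for t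
      using a that unfolding stat by blast
    have "\<bar>W1 T x \<omega>\<bar> \<le> x / sqrt (real n) * b \<and> \<bar>W2 T x \<omega>\<bar> \<le> x / sqrt (real n) * b"
      if x: "real n \<le> x" "x \<le> real T / 2" for x
    proof -
      have "0 < x" using x n0 by linarith
      then show ?thesis unfolding conv[OF \<open>0 < x\<close>]
        using order_trans[OF P.statistic_imp_wiener_band(1)[OF d x] b']
          order_trans[OF P.statistic_imp_wiener_band(2)[OF d x] b'] by blast
    qed
    then show ?thesis using \<omega>(1) unfolding W_band_def pair_band_def n_def by simp
  qed
qed

text \<open>By \<open>measure_W_band\<close> this is eventually the probability of
  \<open>W_band T a\<close>, but expressed through processes that do not depend on T.\<close>

definition inner_cdf :: "nat \<Rightarrow> real \<Rightarrow> real" where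
  "inner_cdf T a = measure N (pair_band N B1 B2 {real (tT T) / (real T / 2)..1} (\<lambda>_. a))"

lemma stat_cdf_squeeze:
  assumes \<delta>: "0 < \<delta>" and \<gamma>: "0 < \<gamma>"
  shows "eventually (\<lambda>T. measure M {\<omega> \<in> space M. stat T \<omega> \<le> a} \<le> inner_cdf T (a + \<delta>) + \<gamma> \<and>
    inner_cdf T (a - \<delta>) \<le> measure M {\<omega> \<in> space M. stat T \<omega> \<le> a} + \<gamma>) sequentially"
proof -
  \<comment> \<open>Budget for the shift \<delta>: 9 (\<delta>/36) and 6 (\<delta>/24) are
    \<delta>/4 each, so the pathwise error is at most \<delta>/2. The other \<delta>/2 pays for the
    factor 1 + 1/n, through (|a| + \<delta>)/n \<le> \<delta>/2. The probability \<gamma> is shared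
    equally by the two exceptional events.\<close>
  have \<gamma>2: "0 < \<gamma> / 2" and \<epsilon>: "0 < \<delta> / 36" using \<gamma> \<delta> by auto
  obtain C where C: "0 \<le> C" and
    good: "eventually (\<lambda>T. \<exists>A\<in>sets M. 1 - \<gamma> / 2 \<le> measure M A \<and> (\<forall>\<omega>\<in>A. good_approx T C \<omega>)) sequentially"
    using good_approx_probable[OF \<gamma>2] by blast
  have top: "filterlim (\<lambda>T. real (tT T)) at_top sequentially"
    by (rule filterlim_compose[OF filterlim_real_sequentially trim_inf])
  have "(\<lambda>T. C / \<sigma> * real (tT T) powr (\<kappa> - 1/2)) \<longlonglongrightarrow> C / \<sigma> * 0"
    using kappa by (intro tendsto_mult tendsto_const tendsto_neg_powr top) auto
  then have "eventually (\<lambda>T. C / \<sigma> * real (tT T) powr (\<kappa> - 1/2) < \<delta> / 24) sequentially"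
    using \<delta> by (intro order_tendstoD) auto
  moreover have "eventually (\<lambda>T. (\<bar>a\<bar> + \<delta>) * 2 / \<delta> \<le> real (tT T)) sequentially"
    using top by (simp add: filterlim_at_top)
  moreover note good small_band_probable[OF \<epsilon> \<gamma>2] eventually_fraction_le[OF zero_less_one]
  ultimately show ?thesis
  proof eventually_elim
    case (elim T)
    let ?\<rho> = "C / \<sigma> * real (tT T) powr (\<kappa> - 1/2)"
    have n: "1 \<le> tT T" "2 * tT T < T" using elim by auto
    have "9 * (\<delta> / 36) + 6 * \<rho> \<le> \<delta> / 2" if "\<rho> < \<delta> / 24" for \<rho> using that by simp
    from this[OF elim(1)] have \<eta>: "9 * (\<delta> / 36) + 6 * ?\<rho> \<le> \<delta> / 2" .
    have b: "(1 + 1 / real (tT T)) * (a + \<delta> / 2) \<le> a + \<delta>"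
    proof -
      have "(a + \<delta> / 2) / real (tT T) \<le> (\<bar>a\<bar> + \<delta>) / real (tT T)"
        using n \<delta> by (intro divide_right_mono) auto
      also have "\<dots> \<le> \<delta> / 2" using elim(2) n \<delta> by (simp add: field_simps)
      finally have "(a + \<delta> / 2) / real (tT T) \<le> \<delta> / 2" .
      moreover have "(1 + 1 / r) * v \<le> v + d" if "v / r \<le> d" for r v d :: real
        using that by (simp add: distrib_right)
      ultimately have "(1 + 1 / real (tT T)) * (a + \<delta> / 2) \<le> a + \<delta> / 2 + \<delta> / 2" by blast
      then show ?thesis by simp
    qed
    obtain A where A: "A \<in> sets M" "1 - \<gamma> / 2 \<le> measure M A" "\<And>\<omega>. \<omega> \<in> A \<Longrightarrow> good_approx T C \<omega>"
      using elim(3) by blast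
    define E where "E = A \<inter> small_band T (\<delta> / 36)"
    have E: "E \<in> sets M" unfolding E_def using A(1) elim(4) by (intro sets.Int) blast+
    have pE: "1 - \<gamma> \<le> measure M E"
      using M.prob_Int_lower[OF A(1), of "small_band T (\<delta> / 36)"] A(2) elim(4) unfolding E_def by linarith
    have S: "{\<omega> \<in> space M. stat T \<omega> \<le> a} \<in> sets M"
      using stat_measurable by measurable
    have sp: "\<omega> \<in> space M" if "\<omega> \<in> E" for \<omega> using that E sets.sets_into_space by blast
    \<comment> \<open>An inclusion valid on \<open>E\<close> only costs the probability of the
      complement of \<open>E\<close>, at most \<gamma>.\<close>
    have le: "measure M X \<le> measure M Y + \<gamma>" if "X \<in> sets M" "Y \<in> sets M" "X \<inter> E \<subseteq> Y" for X Y
      using M.prob_Int_lower[OF that(1) E] M.finite_measure_mono[OF that(3,2)] pE by linarith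
    have G: "inner_cdf T v = measure M (W_band T v)" for v
      unfolding inner_cdf_def measure_W_band(2)[OF n] ..
    have 1: "{\<omega> \<in> space M. stat T \<omega> \<le> a} \<inter> E \<subseteq> W_band T (a + \<delta>)"
      using good_paths(2)[OF n sp _ A(3) C \<eta> _ b] by (auto simp: E_def)
    have 2: "W_band T (a - \<delta>) \<inter> E \<subseteq> {\<omega> \<in> space M. stat T \<omega> \<le> a}"
    proof
      fix \<omega> assume \<omega>: "\<omega> \<in> W_band T (a - \<delta>) \<inter> E"
      then have "stat T \<omega> \<le> a - \<delta> + \<delta> / 2"
        using good_paths(1)[OF n sp _ A(3) C \<eta>, of \<omega> "a - \<delta>"] by (auto simp: E_def)
      then show "\<omega> \<in> {\<omega> \<in> space M. stat T \<omega> \<le> a}" using \<delta> \<omega> sp by auto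
    qed
    show ?case unfolding G
      using le[OF S measure_W_band(1)[OF n] 1] le[OF measure_W_band(1)[OF n] S 2] by blast
  qed
qed

lemma stat_weak_conv:
  "weak_conv_m (\<lambda>T. distr M borel (stat T))
     (distr N borel (\<lambda>\<omega>. max (SUP u\<in>{0..1}. \<bar>B1 u \<omega>\<bar>) (SUP u\<in>{0..1}. \<bar>B2 u \<omega>\<bar>)))"
  unfolding weak_conv_m_def weak_conv_def
proof (intro allI impI)
  let ?G = "cdf (distr N borel (\<lambda>\<omega>. max (SUP u\<in>{0..1}. \<bar>B1 u \<omega>\<bar>) (SUP u\<in>{0..1}. \<bar>B2 u \<omega>\<bar>)))"
  fix a assume cont: "isCont ?G a"
  have G: "?G v = measure N (pair_band N B1 B2 {0..1} (\<lambda>_. v))" for v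
    by (rule cdf_pair_sup(2)[OF N.prob_space_axioms B1_wiener B2_wiener])
  have F: "cdf (distr M borel (stat T)) v = measure M {\<omega> \<in> space M. stat T \<omega> \<le> v}" for T v
    unfolding cdf_def using stat_measurable by (simp add: measure_distr vimage_def Int_def conj_commute)
  show "(\<lambda>T. cdf (distr M borel (stat T)) a) \<longlonglongrightarrow> ?G a"
  proof (rule tendstoI)
    fix r :: real assume "0 < r"
    \<comment> \<open>The upper estimate spends three \<gamma>: the squeeze, the gap near time 0,
      and continuity of the limit distribution function at \<open>a\<close>. The lower one spends
      two.\<close>
    define \<gamma> where "\<gamma> = r / 4"
    have \<gamma>: "0 < \<gamma>" using \<open>0 < r\<close> by (simp add: \<gamma>_def)
    obtain s where s: "0 < s" "\<And>v. \<bar>v - a\<bar> < s \<Longrightarrow> \<bar>?G v - ?G a\<bar> < \<gamma>"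
      using cont \<gamma> unfolding continuous_at_eps_delta dist_real_def by blast
    define \<delta> where "\<delta> = s / 2"
    have \<delta>: "0 < \<delta>" "\<bar>?G (a + \<delta>) - ?G a\<bar> < \<gamma>" "\<bar>?G (a - \<delta>) - ?G a\<bar> < \<gamma>"
      using s by (auto simp: \<delta>_def)
    obtain \<alpha> where \<alpha>: "0 < \<alpha>" "\<And>\<beta>. 0 < \<beta> \<Longrightarrow> \<beta> \<le> \<alpha> \<Longrightarrow>
        measure N (pair_band N B1 B2 {\<beta>..1} (\<lambda>_. a + \<delta>)) \<le> ?G (a + \<delta>) + \<gamma>"
      using pair_band_near_zero[OF N.prob_space_axioms B1_wiener B2_wiener \<gamma>, of "a + \<delta>"] unfolding G by blast
    show "eventually (\<lambda>T. dist (cdf (distr M borel (stat T)) a) (?G a) < r) sequentially"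
      using eventually_fraction_le[OF \<alpha>(1)] stat_cdf_squeeze[OF \<delta>(1) \<gamma>, of a]
    proof eventually_elim
      case (elim T)
      have f: "0 < real (tT T) / (real T / 2)" "real (tT T) / (real T / 2) < 1" using elim(1) by auto
      have "inner_cdf T (a + \<delta>) \<le> ?G (a + \<delta>) + \<gamma>"
        unfolding inner_cdf_def using \<alpha>(2)[OF f(1)] elim(1) by blast
      \<comment> \<open>On this side shortening the time interval only enlarges the band event, so
        monotonicity replaces the limit near time 0.\<close>
      moreover have "?G (a - \<delta>) \<le> inner_cdf T (a - \<delta>)"
        unfolding G inner_cdf_def using f
        by (intro N.finite_measure_mono pair_band_mono pair_band_sets[OF B1_wiener B2_wiener]) auto
      ultimately show ?case using elim(2) \<delta>(2,3) \<gamma> unfolding F dist_real_def \<gamma>_def by linarith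
    qed
  qed
qed

end

theorem theorem2p1:
  fixes M :: "'a measure" and N :: "'b measure"
    and mu :: "nat \<Rightarrow> real" and e :: "nat \<Rightarrow> 'a \<Rightarrow> real"
    and tT :: "nat \<Rightarrow> nat"
    and \<sigma> \<kappa> :: real
    and W1 W2 :: "nat \<Rightarrow> real \<Rightarrow> 'a \<Rightarrow> real"
    and B1 B2 :: "real \<Rightarrow> 'b \<Rightarrow> real"
  assumes M: "prob_space M"
    and e_rv: "\<And>s. s \<ge> 1 \<Longrightarrow> e s \<in> borel_measurable M"
    and e_int: "\<And>s. s \<ge> 1 \<Longrightarrow> integrable M (e s)"
    and e_mean: "\<And>s. s \<ge> 1 \<Longrightarrow> (\<integral>\<omega>. e s \<omega> \<partial>M) = 0"
    and H0: "\<And>s t. s \<ge> 1 \<Longrightarrow> t \<ge> 1 \<Longrightarrow> mu s = mu t"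
    and trim_inf: "filterlim tT at_top sequentially"
    and trim_small: "(\<lambda>T. real (tT T) / real T) \<longlonglongrightarrow> 0"
    and sigma_pos: "\<sigma> > 0"
    and kappa: "0 < \<kappa>" "\<kappa> < 1/2"
    and W1_wiener: "\<And>T. wiener_on M (real T / 2) (W1 T)"
    and W2_wiener: "\<And>T. wiener_on M (real T / 2) (W2 T)"
    and W12_indep: "\<And>T. indep_processes M (real T / 2) (W1 T) (W2 T)"
    and approx1: "bounded_in_prob M (\<lambda>T \<omega>.
        SUP x\<in>{1..real T / 2}. x powr (-\<kappa>) *
          \<bar>(\<Sum>s=1..nat \<lfloor>x\<rfloor>. e s \<omega>) - \<sigma> * W1 T x \<omega>\<bar>)"
    and approx2: "bounded_in_prob M (\<lambda>T \<omega>.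
        SUP x\<in>{real T / 2..real T - 1}. (real T - x) powr (-\<kappa>) *
          \<bar>(\<Sum>s=nat \<lfloor>x\<rfloor>+1..T. e s \<omega>) - \<sigma> * W2 T (real T - x) \<omega>\<bar>)"
    and N: "prob_space N"
    and B1_wiener: "wiener_on N 1 B1"
    and B2_wiener: "wiener_on N 1 B2"
    and B12_indep: "indep_processes N 1 B1 B2"
  shows "weak_conv_m
     (\<lambda>T. distr M borel (\<lambda>\<omega>. sqrt (real (tT T)) *
            D_stat (\<lambda>s \<omega>. mu s + e s \<omega>) (tT T) T \<omega> / \<sigma>))
     (distr N borel (\<lambda>\<omega>. max (SUP u\<in>{0..1}. \<bar>B1 u \<omega>\<bar>) (SUP u\<in>{0..1}. \<bar>B2 u \<omega>\<bar>)))"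
proof -
  interpret trimmed_approximation M N mu e tT \<sigma> \<kappa> W1 W2 B1 B2
    by (intro trimmed_approximation.intro trimmed_approximation_axioms.intro assms)
  show ?thesis using stat_weak_conv unfolding stat_def[abs_def] .
qed

end
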